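(* Let $S$ be a self-adjoint restriction of $T_{\max}$ (with separated boundary conditions if $\tau$ is in the limit-circle case at both endpoints), and assume that there is a real entire fundamental system $\theta_z,\phi_z$ of $(\tau-z)u=0$ with $W(\theta_z,\phi_z)=1$ such that $\phi_z$ lies in $\operatorname{dom}(S)$ near $a$. Let $\mu$ be the associated spectral measure, $\mathcal F:L^2((a,b);r(x)dx)\to L^2(\mathbb R;d\mu)$ the associated isometry, and $\mathcal G:L^2(\mathbb R;d\mu)\to L^2((a,b);r(x)dx)$ the bounded operator extending $g\mapsto\check g$. Then $\mathcal F$ is unitary with inverse $\mathcal G$.
   Context: Setting. $(a,b)\subseteq\mathbb R$ is an open interval (possibly unbounded); $p,q,r,s$ are Lebesgue measurable and real-valued a.e. on $(a,b)$, with $p^{-1},q,r,s\in L^1_{\mathrm{loc}}((a,b);dx)$, $r>0$ and $p\neq0$ a.e. For $f\in AC_{\mathrm{loc}}((a,b))$ put $f^{[1]}=p(f'+sf)$, $\mathfrak D_\tau=\{f\in AC_{\mathrm{loc}}((a,b)) : f^{[1]}\in AC_{\mathrm{loc}}((a,b))\}$, and $\tau f=\frac1r\big(-(f^{[1]})'+sf^{[1]}+qf\big)$ for $f\in\mathfrak D_\tau$. The Wronskian is $W(f,g)=fg^{[1]}-f^{[1]}g$; its limits at an endpoint exist whenever $f,g\in\mathfrak D_\tau$ and $f,\tau f,g,\tau g$ lie in $L^2$ near that endpoint. In $L^2((a,b);r(x)dx)$ the maximal operator is $T_{\max}f=\tau f$, $\operatorname{dom}(T_{\max})=\{g\in L^2((a,b);r\,dx):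 g\in\mathfrak D_\tau,\ \tau g\in L^2((a,b);r\,dx)\}$. A function lies in $L^2$ near $a$ (resp. $b$) if it lies in $L^2((a,c);r\,dx)$ (resp. $L^2((c,b);r\,dx)$) for each $c\in(a,b)$. $\tau$ is in the limit-circle case at an endpoint if for each $z\in\mathbb C$ all solutions of $(\tau-z)u=0$ lie in $L^2$ near that endpoint, and in the limit-point case if for each $z\in\mathbb C$ some solution does not. Form of $S$. $S$ is $\tau$ restricted to those $g\in\operatorname{dom}(T_{\max})$ which satisfy, at each limit-circle endpoint $c$, the boundary condition $W(g,\overline{v_c})(c)=0$, where $v_c\in\operatorname{dom}(T_{\max})$ is fixed with $W(v_c,\overline{v_c})(c)=0$ and $W(h,\overline{v_c})(c)\neq0$ for some $h\in\operatorname{dom}(T_{\max})$; no condition at limit-point endpoints. A solution $u$ of $(\tau-z)u=0$ lies in $\operatorname{dom}(S)$ near an endpoint $c$ if it lies in $L^2$ near $c$ and, when $\tau$ is limit-circle at $c$, satisfies the boundary condition of $S$ at $c$. Real entire fundamental system: for each $z\in\mathbb C$, $\theta_z,\phi_z$ are linearly independent solutions of $(\tau-z)u=0$ such that for each $x\in(a,b)$ the functions $z\mapsto\theta_z(x),\theta_z^{[1]}(x),\phi_z(x),\phi_z^{[1]}(x)$ are entire and real for $z\in\mathbb R$. The singular Weyl–Titchmarsh–Kodaira function $m:\rho(S)\to\mathbb C$ is determined by requiring that $\theta_z+m(z)\phi_z$ lies in $\operatorname{dom}(S)$ near $b$. Spectral measure and transforms. For $f\in L^2_c((a,b);r\,dx)$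 (square integrable with compact support in $(a,b)$) put $\hat f(z)=\int_a^b\phi_z(x)f(x)\,r(x)dx$, $z\in\mathbb C$. There is a unique Borel measure $\mu$ on $\mathbb R$ given by $$\mu((\lambda_1,\lambda_2])=\lim_{\delta\downarrow0}\lim_{\varepsilon\downarrow0}\frac1\pi\int_{\lambda_1+\delta}^{\lambda_2+\delta}\operatorname{Im}\big(m(\lambda+i\varepsilon)\big)\,d\lambda,\quad\lambda_1<\lambda_2,$$ and it satisfies $dE_{f,g}=\hat f\,\overline{\hat g}\,d\mu$ for $f,g\in L^2_c((a,b);r\,dx)$, where $E_{f,g}$ is the complex measure with $\langle(S-z)^{-1}f,g\rangle=\int_{\mathbb R}(\lambda-z)^{-1}dE_{f,g}(\lambda)$ (these facts may be taken as known). Hence $f\mapsto\hat f$ extends uniquely to an isometry $\mathcal F$ from $L^2((a,b);r\,dx)$ into $L^2(\mathbb R;d\mu)$. For $g\in L^2(\mathbb R;d\mu)$ with compact support put $\check g(x)=\int_{\mathbb R}\phi_\lambda(x)g(\lambda)\,d\mu(\lambda)$, $x\in(a,b)$; then $\|\check g\|_{L^2((a,b);r\,dx)}\le\|g\|_{L^2(\mathbb R;d\mu)}$, and $\mathcal G$ denotes the unique bounded extension of $g\mapsto\check g$ to $L^2(\mathbb R;d\mu)$. *)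

theory Defs
  imports "HOL-Analysis.Analysis"
begin

section \<open>Square integrable functions and operators between $L^2$ spaces\<close>

text \<open>Elements of an $L^2$ space are handled through representing functions. Accordingly, operators
  act on representatives, and all identities between elements hold almost everywhere. Linearity
  together with boundedness makes such an operator well defined on classes.\<close>

definition L2 :: "'a measure \<Rightarrow> ('a \<Rightarrow> complex) set" where
  "L2 M = {f. f \<in> borel_measurable M \<and> integrable M (\<lambda>x. (cmod (f x))\<^sup>2)}"

definition L2_inner :: "'a measure \<Rightarrow> ('a \<Rightarrow> complex) \<Rightarrow> ('a \<Rightarrow> complex) \<Rightarrow> complex" where
  "L2_inner M f g = (LINT x|M. f x * cnj (g x))"

definition L2_norm :: "'a measure \<Rightarrow> ('a \<Rightarrow> complex) \<Rightarrow> real" where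
  "L2_norm M f = sqrt (LINT x|M. (cmod (f x))\<^sup>2)"

definition L2_linear ::
  "'a measure \<Rightarrow> 'b measure \<Rightarrow> (('a \<Rightarrow> complex) \<Rightarrow> ('b \<Rightarrow> complex)) \<Rightarrow> bool" where
  "L2_linear M N F \<longleftrightarrow>
     (\<forall>f\<in>L2 M. F f \<in> L2 N) \<and>
     (\<forall>f\<in>L2 M. \<forall>g\<in>L2 M. \<forall>\<alpha> \<beta>.
        AE y in N. F (\<lambda>x. \<alpha> * f x + \<beta> * g x) y = \<alpha> * F f y + \<beta> * F g y)"

definition L2_bounded_linear ::
  "'a measure \<Rightarrow> 'b measure \<Rightarrow> (('a \<Rightarrow> complex) \<Rightarrow> ('b \<Rightarrow> complex)) \<Rightarrow> bool" where
  "L2_bounded_linear M N F \<longleftrightarrow>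
     L2_linear M N F \<and> (\<exists>C. \<forall>f\<in>L2 M. L2_norm N (F f) \<le> C * L2_norm M f)"

definition L2_isometry ::
  "'a measure \<Rightarrow> 'b measure \<Rightarrow> (('a \<Rightarrow> complex) \<Rightarrow> ('b \<Rightarrow> complex)) \<Rightarrow> bool" where
  "L2_isometry M N F \<longleftrightarrow>
     L2_linear M N F \<and> (\<forall>f\<in>L2 M. L2_norm N (F f) = L2_norm M f)"

definition L2_unitary ::
  "'a measure \<Rightarrow> 'b measure \<Rightarrow> (('a \<Rightarrow> complex) \<Rightarrow> ('b \<Rightarrow> complex)) \<Rightarrow> bool" where
  "L2_unitary M N F \<longleftrightarrow>
     L2_linear M N F \<and>
     (\<forall>f\<in>L2 M. \<forall>g\<in>L2 M. L2_inner N (F f) (F g) = L2_inner M f g) \<and>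
     (\<forall>h\<in>L2 N. \<exists>f\<in>L2 M. AE y in N. F f y = h y)"

definition L2_inverse ::
  "'a measure \<Rightarrow> 'b measure \<Rightarrow> (('a \<Rightarrow> complex) \<Rightarrow> ('b \<Rightarrow> complex)) \<Rightarrow>
     (('b \<Rightarrow> complex) \<Rightarrow> ('a \<Rightarrow> complex)) \<Rightarrow> bool" where
  "L2_inverse M N F G \<longleftrightarrow>
     (\<forall>f\<in>L2 M. G (F f) \<in> L2 M \<and> (AE x in M. G (F f) x = f x)) \<and>
     (\<forall>h\<in>L2 N. F (G h) \<in> L2 N \<and> (AE y in N. F (G h) y = h y))"


section \<open>Unbounded operators in an $L^2$ space\<close>

text \<open>An operator is given by its domain \<open>D\<close>, a set of functions, and its action \<open>A\<close>.
  The last conjunct says that the graph of the adjoint is the graph of the operator, both read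
  modulo almost everywhere equality.\<close>

definition self_adjoint_operator ::
  "'a measure \<Rightarrow> ('a \<Rightarrow> complex) set \<Rightarrow> (('a \<Rightarrow> complex) \<Rightarrow> ('a \<Rightarrow> complex)) \<Rightarrow> bool" where
  "self_adjoint_operator M D A \<longleftrightarrow>
     D \<subseteq> L2 M \<and> (\<forall>f\<in>D. A f \<in> L2 M) \<and>
     (\<forall>f\<in>L2 M. \<forall>\<epsilon>>0. \<exists>g\<in>D. L2_norm M (\<lambda>x. f x - g x) < \<epsilon>) \<and>
     (\<forall>g\<in>L2 M. \<forall>h\<in>L2 M.
        (\<forall>f\<in>D. L2_inner M (A f) g = L2_inner M f h) \<longleftrightarrow>
        (\<exists>g'\<in>D. (AE x in M. g' x = g x) \<and> (AE x in M. A g' x = h x)))"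

text \<open>The norm estimate contains both injectivity of $A - z$ and boundedness of the inverse.\<close>

definition resolvent_set ::
  "'a measure \<Rightarrow> ('a \<Rightarrow> complex) set \<Rightarrow> (('a \<Rightarrow> complex) \<Rightarrow> ('a \<Rightarrow> complex)) \<Rightarrow> complex set" where
  "resolvent_set M D A =
     {z. (\<forall>f\<in>L2 M. \<exists>g\<in>D. AE x in M. A g x - z * g x = f x) \<and>
         (\<exists>C. \<forall>g\<in>D. L2_norm M g \<le> C * L2_norm M (\<lambda>x. A g x - z * g x))}"

text \<open>For \<open>z\<close> in the resolvent set the choice is unique up to almost everywhere equality.\<close>

definition resolvent ::
  "'a measure \<Rightarrow> ('a \<Rightarrow> complex) set \<Rightarrow> (('a \<Rightarrow> complex) \<Rightarrow> ('a \<Rightarrow> complex)) \<Rightarrow>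
     complex \<Rightarrow> ('a \<Rightarrow> complex) \<Rightarrow> ('a \<Rightarrow> complex)" where
  "resolvent M D A z f = (SOME g. g \<in> D \<and> (AE x in M. A g x - z * g x = f x))"

text \<open>A complex Borel measure on the line is a set function $\nu = (\nu_1 - \nu_2) + i (\nu_3 - \nu_4)$
  with finite positive Borel measures $\nu_k$; integration against $\nu$ is defined accordingly. The
  value of the integral does not depend on the decomposition.\<close>

definition complex_measure_decomp ::
  "(real set \<Rightarrow> complex) \<Rightarrow> real measure \<Rightarrow> real measure \<Rightarrow> real measure \<Rightarrow> real measure \<Rightarrow> bool" where
  "complex_measure_decomp \<nu> \<nu>1 \<nu>2 \<nu>3 \<nu>4 \<longleftrightarrow>
     (\<forall>\<rho>\<in>{\<nu>1, \<nu>2, \<nu>3, \<nu>4}. finite_measure \<rho> \<and> sets \<rho> = sets borel) \<and>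
     (\<forall>A\<in>sets borel. \<nu> A = Complex (measure \<nu>1 A - measure \<nu>2 A) (measure \<nu>3 A - measure \<nu>4 A))"

definition has_complex_measure_integral ::
  "(real set \<Rightarrow> complex) \<Rightarrow> (real \<Rightarrow> complex) \<Rightarrow> complex \<Rightarrow> bool" where
  "has_complex_measure_integral \<nu> h c \<longleftrightarrow>
     (\<exists>\<nu>1 \<nu>2 \<nu>3 \<nu>4. complex_measure_decomp \<nu> \<nu>1 \<nu>2 \<nu>3 \<nu>4 \<and>
        (\<forall>\<rho>\<in>{\<nu>1, \<nu>2, \<nu>3, \<nu>4}. integrable \<rho> h) \<and>
        c = ((LINT t|\<nu>1. h t) - (LINT t|\<nu>2. h t)) + \<i> * ((LINT t|\<nu>3. h t) - (LINT t|\<nu>4. h t)))"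

text \<open>\<open>E\<close> is the complex measure $E_{f,g}$ of the self-adjoint operator \<open>(D, A)\<close>.\<close>

definition resolvent_measure ::
  "'a measure \<Rightarrow> ('a \<Rightarrow> complex) set \<Rightarrow> (('a \<Rightarrow> complex) \<Rightarrow> ('a \<Rightarrow> complex)) \<Rightarrow>
     ('a \<Rightarrow> complex) \<Rightarrow> ('a \<Rightarrow> complex) \<Rightarrow> (real set \<Rightarrow> complex) \<Rightarrow> bool" where
  "resolvent_measure M D A f g E \<longleftrightarrow>
     (\<forall>z\<in>resolvent_set M D A.
        has_complex_measure_integral E (\<lambda>t. inverse (complex_of_real t - z))
          (L2_inner M (resolvent M D A z f) g))"


section \<open>Sturm--Liouville expressions with distributional coefficients\<close>

record sl_data =
  left_end :: ereal
  right_end :: ereal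
  p_coeff :: "real \<Rightarrow> real"
  q_coeff :: "real \<Rightarrow> real"
  r_coeff :: "real \<Rightarrow> real"
  s_coeff :: "real \<Rightarrow> real"

definition sl_interval :: "sl_data \<Rightarrow> real set" where
  "sl_interval T = einterval (left_end T) (right_end T)"

definition L1_loc :: "sl_data \<Rightarrow> (real \<Rightarrow> real) \<Rightarrow> bool" where
  "L1_loc T f \<longleftrightarrow> (\<forall>c d. {c..d} \<subseteq> sl_interval T \<longrightarrow> f absolutely_integrable_on {c..d})"

definition sl_expression :: "sl_data \<Rightarrow> bool" where
  "sl_expression T \<longleftrightarrow>
     left_end T < right_end T \<and>
     (\<forall>c\<in>{p_coeff T, q_coeff T, r_coeff T, s_coeff T}.
        c \<in> borel_measurable (lebesgue_on (sl_interval T))) \<and>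
     L1_loc T (\<lambda>x. inverse (p_coeff T x)) \<and> L1_loc T (q_coeff T) \<and>
     L1_loc T (r_coeff T) \<and> L1_loc T (s_coeff T) \<and>
     (AE x in lebesgue_on (sl_interval T). r_coeff T x > 0 \<and> p_coeff T x \<noteq> 0)"

definition abs_cont_on :: "real \<Rightarrow> real \<Rightarrow> (real \<Rightarrow> complex) \<Rightarrow> bool" where
  "abs_cont_on c d f \<longleftrightarrow>
     (\<forall>\<epsilon>>0. \<exists>\<delta>>0. \<forall>P. finite P \<longrightarrow>
        (\<forall>(u, w)\<in>P. c \<le> u \<and> u \<le> w \<and> w \<le> d) \<longrightarrow>
        disjoint_family_on (\<lambda>(u, w). {u<..<w}) P \<longrightarrow>
        (\<Sum>(u, w)\<in>P. w - u) < \<delta> \<longrightarrow> (\<Sum>(u, w)\<in>P. cmod (f w - f u)) < \<epsilon>)"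

definition AC_loc :: "sl_data \<Rightarrow> (real \<Rightarrow> complex) set" where
  "AC_loc T = {f. \<forall>c d. {c..d} \<subseteq> sl_interval T \<longrightarrow> abs_cont_on c d f}"

text \<open>The formula $p (f' + s f)$ determines $f^{[1]}$ only almost everywhere. For $f$ in
  $\mathfrak D_\tau$ the function $f^{[1]}$ is its locally absolutely continuous representative,
  which is unique on the interval.\<close>

definition is_quasi_deriv :: "sl_data \<Rightarrow> (real \<Rightarrow> complex) \<Rightarrow> (real \<Rightarrow> complex) \<Rightarrow> bool" where
  "is_quasi_deriv T f h \<longleftrightarrow>
     h \<in> AC_loc T \<and>
     (AE x in lebesgue_on (sl_interval T).
        h x = of_real (p_coeff T x) * (vector_derivative f (at x) + of_real (s_coeff T x) * f x))"

definition D_tau :: "sl_data \<Rightarrow> (real \<Rightarrow> complex) set" where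
  "D_tau T = {f \<in> AC_loc T. \<exists>h. is_quasi_deriv T f h}"

definition quasi_deriv :: "sl_data \<Rightarrow> (real \<Rightarrow> complex) \<Rightarrow> (real \<Rightarrow> complex)" where
  "quasi_deriv T f = (SOME h. is_quasi_deriv T f h)"

definition tau :: "sl_data \<Rightarrow> (real \<Rightarrow> complex) \<Rightarrow> (real \<Rightarrow> complex)" where
  "tau T f x =
     (- vector_derivative (quasi_deriv T f) (at x) + of_real (s_coeff T x) * quasi_deriv T f x
        + of_real (q_coeff T x) * f x) / of_real (r_coeff T x)"

definition wronskian :: "sl_data \<Rightarrow> (real \<Rightarrow> complex) \<Rightarrow> (real \<Rightarrow> complex) \<Rightarrow> real \<Rightarrow> complex" where
  "wronskian T f g x = f x * quasi_deriv T g x - quasi_deriv T f x * g x"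

definition solution :: "sl_data \<Rightarrow> complex \<Rightarrow> (real \<Rightarrow> complex) \<Rightarrow> bool" where
  "solution T z u \<longleftrightarrow>
     u \<in> D_tau T \<and> (AE x in lebesgue_on (sl_interval T). tau T u x - z * u x = 0)"

text \<open>The measure $r(x)\,dx$ on a subset of the interval.\<close>

definition weighted_on :: "sl_data \<Rightarrow> real set \<Rightarrow> real measure" where
  "weighted_on T X = density (lebesgue_on X) (\<lambda>x. ennreal (r_coeff T x))"

abbreviation weighted :: "sl_data \<Rightarrow> real measure" where
  "weighted T \<equiv> weighted_on T (sl_interval T)"

definition dom_max :: "sl_data \<Rightarrow> (real \<Rightarrow> complex) set" where
  "dom_max T = {g \<in> L2 (weighted T). g \<in> D_tau T \<and> tau T g \<in> L2 (weighted T)}"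


subsection \<open>Endpoints and boundary conditions\<close>

datatype endpoint = Lower | Upper

fun near_end :: "sl_data \<Rightarrow> endpoint \<Rightarrow> real \<Rightarrow> real set" where
  "near_end T Lower c = einterval (left_end T) (ereal c)"
| "near_end T Upper c = einterval (ereal c) (right_end T)"

fun end_filter :: "sl_data \<Rightarrow> endpoint \<Rightarrow> real filter" where
  "end_filter T Lower = filtermap real_of_ereal (at_right (left_end T))"
| "end_filter T Upper = filtermap real_of_ereal (at_left (right_end T))"

definition L2_near :: "sl_data \<Rightarrow> endpoint \<Rightarrow> (real \<Rightarrow> complex) \<Rightarrow> bool" where
  "L2_near T e f \<longleftrightarrow> (\<forall>c\<in>sl_interval T. f \<in> L2 (weighted_on T (near_end T e c)))"

definition limit_circle :: "sl_data \<Rightarrow> endpoint \<Rightarrow> bool" where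
  "limit_circle T e \<longleftrightarrow> (\<forall>z u. solution T z u \<longrightarrow> L2_near T e u)"

definition boundary_condition ::
  "sl_data \<Rightarrow> endpoint \<Rightarrow> (real \<Rightarrow> complex) \<Rightarrow> (real \<Rightarrow> complex) \<Rightarrow> bool" where
  "boundary_condition T e w g \<longleftrightarrow> (wronskian T g (\<lambda>x. cnj (w x)) \<longlongrightarrow> 0) (end_filter T e)"

definition boundary_function :: "sl_data \<Rightarrow> endpoint \<Rightarrow> (real \<Rightarrow> complex) \<Rightarrow> bool" where
  "boundary_function T e w \<longleftrightarrow>
     w \<in> dom_max T \<and> boundary_condition T e w w \<and>
     (\<exists>h\<in>dom_max T. \<exists>L. L \<noteq> 0 \<and> (wronskian T h (\<lambda>x. cnj (w x)) \<longlongrightarrow> L) (end_filter T e))"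

text \<open>The domain of the restriction $S$ of the maximal operator with separated boundary conditions;
  \<open>v e\<close> is irrelevant when \<open>e\<close> is not a limit-circle endpoint.\<close>

definition dom_S :: "sl_data \<Rightarrow> (endpoint \<Rightarrow> real \<Rightarrow> complex) \<Rightarrow> (real \<Rightarrow> complex) set" where
  "dom_S T v = {g \<in> dom_max T. \<forall>e. limit_circle T e \<longrightarrow> boundary_condition T e (v e) g}"

definition rho_S :: "sl_data \<Rightarrow> (endpoint \<Rightarrow> real \<Rightarrow> complex) \<Rightarrow> complex set" where
  "rho_S T v = resolvent_set (weighted T) (dom_S T v) (tau T)"

definition in_dom_S_near ::
  "sl_data \<Rightarrow> (endpoint \<Rightarrow> real \<Rightarrow> complex) \<Rightarrow> endpoint \<Rightarrow> (real \<Rightarrow> complex) \<Rightarrow> bool" where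
  "in_dom_S_near T v e u \<longleftrightarrow>
     L2_near T e u \<and> (limit_circle T e \<longrightarrow> boundary_condition T e (v e) u)"


subsection \<open>Singular Weyl--Titchmarsh--Kodaira theory\<close>

definition real_entire :: "(complex \<Rightarrow> complex) \<Rightarrow> bool" where
  "real_entire h \<longleftrightarrow> h holomorphic_on UNIV \<and> (\<forall>t::real. h (of_real t) \<in> \<real>)"

definition real_entire_fundamental_system ::
  "sl_data \<Rightarrow> (complex \<Rightarrow> real \<Rightarrow> complex) \<Rightarrow> (complex \<Rightarrow> real \<Rightarrow> complex) \<Rightarrow> bool" where
  "real_entire_fundamental_system T \<theta> \<phi> \<longleftrightarrow>
     (\<forall>z. solution T z (\<theta> z) \<and> solution T z (\<phi> z) \<and>
        (\<forall>\<alpha> \<beta>. (\<forall>x\<in>sl_interval T. \<alpha> * \<theta> z x + \<beta> * \<phi> z x = 0) \<longrightarrow> \<alpha> = 0 \<and> \<beta> = 0)) \<and>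
     (\<forall>x\<in>sl_interval T.
        real_entire (\<lambda>z. \<theta> z x) \<and> real_entire (\<lambda>z. quasi_deriv T (\<theta> z) x) \<and>
        real_entire (\<lambda>z. \<phi> z x) \<and> real_entire (\<lambda>z. quasi_deriv T (\<phi> z) x))"

definition singular_weyl_function ::
  "sl_data \<Rightarrow> (endpoint \<Rightarrow> real \<Rightarrow> complex) \<Rightarrow> (complex \<Rightarrow> real \<Rightarrow> complex) \<Rightarrow>
     (complex \<Rightarrow> real \<Rightarrow> complex) \<Rightarrow> (complex \<Rightarrow> complex) \<Rightarrow> bool" where
  "singular_weyl_function T v \<theta> \<phi> m \<longleftrightarrow>
     (\<forall>z\<in>rho_S T v. in_dom_S_near T v Upper (\<lambda>x. \<theta> z x + m z * \<phi> z x))"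

text \<open>The values on bounded half-open intervals are finite, hence they determine the measure.
  The function \<open>L\<close> is the inner limit as a function of the outer variable.\<close>

definition spectral_measure :: "(complex \<Rightarrow> complex) \<Rightarrow> real measure \<Rightarrow> bool" where
  "spectral_measure m \<mu> \<longleftrightarrow>
     sets \<mu> = sets borel \<and>
     (\<forall>l1 l2. l1 < l2 \<longrightarrow>
        emeasure \<mu> {l1<..l2} \<noteq> \<infinity> \<and>
        (\<exists>L. (\<forall>\<^sub>F \<delta> in at_right 0.
                ((\<lambda>\<epsilon>. 1 / pi * (LINT l:{l1 + \<delta>..l2 + \<delta>}|lebesgue. Im (m (Complex l \<epsilon>))))
                   \<longlongrightarrow> L \<delta>) (at_right 0)) \<and>
             (L \<longlongrightarrow> measure \<mu> {l1<..l2}) (at_right 0)))"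

definition L2_c :: "sl_data \<Rightarrow> (real \<Rightarrow> complex) set" where
  "L2_c T = {f \<in> L2 (weighted T). \<exists>c d. {c..d} \<subseteq> sl_interval T \<and>
               (AE x in weighted T. x \<notin> {c..d} \<longrightarrow> f x = 0)}"

definition hat :: "sl_data \<Rightarrow> (complex \<Rightarrow> real \<Rightarrow> complex) \<Rightarrow> (real \<Rightarrow> complex) \<Rightarrow> complex \<Rightarrow> complex" where
  "hat T \<phi> f z = (LINT x|weighted T. \<phi> z x * f x)"

definition L2_compact :: "real measure \<Rightarrow> (real \<Rightarrow> complex) set" where
  "L2_compact \<mu> = {g \<in> L2 \<mu>. \<exists>c d. AE t in \<mu>. t \<notin> {c..d} \<longrightarrow> g t = 0}"

definition check :: "real measure \<Rightarrow> (complex \<Rightarrow> real \<Rightarrow> complex) \<Rightarrow> (real \<Rightarrow> complex) \<Rightarrow> real \<Rightarrow> complex" where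
  "check \<mu> \<phi> g x = (LINT t|\<mu>. \<phi> (of_real t) x * g t)"

text \<open>$dE_{f,g} = \hat f\,\overline{\hat g}\,d\mu$ for all compactly supported $f, g$: the complex
  measure with this density has the defining property of $E_{f,g}$.\<close>

definition spectral_density_formula ::
  "sl_data \<Rightarrow> (endpoint \<Rightarrow> real \<Rightarrow> complex) \<Rightarrow> (complex \<Rightarrow> real \<Rightarrow> complex) \<Rightarrow> real measure \<Rightarrow> bool" where
  "spectral_density_formula T v \<phi> \<mu> \<longleftrightarrow>
     (\<forall>f\<in>L2_c T. \<forall>g\<in>L2_c T.
        integrable \<mu> (\<lambda>t. hat T \<phi> f (of_real t) * cnj (hat T \<phi> g (of_real t))) \<and>
        resolvent_measure (weighted T) (dom_S T v) (tau T) f g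
          (\<lambda>A. LINT t:A|\<mu>. hat T \<phi> f (of_real t) * cnj (hat T \<phi> g (of_real t))))"

definition spectral_transform ::
  "sl_data \<Rightarrow> (complex \<Rightarrow> real \<Rightarrow> complex) \<Rightarrow> real measure \<Rightarrow>
     ((real \<Rightarrow> complex) \<Rightarrow> (real \<Rightarrow> complex)) \<Rightarrow> bool" where
  "spectral_transform T \<phi> \<mu> F \<longleftrightarrow>
     L2_isometry (weighted T) \<mu> F \<and>
     (\<forall>f\<in>L2_c T. AE t in \<mu>. F f t = hat T \<phi> f (of_real t))"

definition inverse_spectral_transform ::
  "sl_data \<Rightarrow> (complex \<Rightarrow> real \<Rightarrow> complex) \<Rightarrow> real measure \<Rightarrow>
     ((real \<Rightarrow> complex) \<Rightarrow> (real \<Rightarrow> complex)) \<Rightarrow> bool" where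
  "inverse_spectral_transform T \<phi> \<mu> G \<longleftrightarrow>
     L2_bounded_linear \<mu> (weighted T) G \<and>
     (\<forall>g\<in>L2_compact \<mu>. AE x in weighted T. G g x = check \<mu> \<phi> g x)"

end

theory Submission
  imports Defs
begin

text \<open>
  A truncation argument and Fubini's theorem show that $\mathcal G$ is the adjoint of $\mathcal F$, so
  $\mathcal G \mathcal F = 1$ because $\mathcal F$ is isometric. It remains to see that any $g$
  orthogonal to the range of $\mathcal F$ vanishes. For nonreal $z$ the density formula together with a
  comparison of norms yields $\mathcal F (S - z)^{-1} f = (\lambda - z)^{-1} \mathcal F f$, hence the
  Stieltjes transform of the complex measure $\mathcal F f \, \overline g \, d\mu$ vanishes, and
  therefore $\hat f(\lambda)\, \overline{g(\lambda)} = 0$ almost everywhere for each compactly supported $f$.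
  Letting $f$ run through the indicators of rational intervals gives $g = 0$, because no $\phi_\lambda$
  vanishes identically.
\<close>

section \<open>The Hilbert space structure of $L^2$\<close>

text \<open>The crux is that the range of \<open>F\<close> is stable under multiplication by
  \<open>inverse (t - z)\<close>, whereas the density formula only speaks of inner products with
  elements of that range. The comparison of norms rests on an identity valid on both sides. With u
  the resolvent applied to f, self-adjointness gives Im <u, f> = Im z * |u|^2, and pointwise Im (1 /
  (t - z)) = Im z / |t - z|^2. Testing the weak identity with f itself therefore equates the norm of
  u with that of \<open>F f / (t - z)\<close>, and a vector as long as its projection to a subspace
  lies in that subspace. Only nonreal z enter, because these belong to the resolvent set of every
  self-adjoint operator; their Cauchy kernels generate the Poisson kernels, which suffice to recover
  a complex measure. A second theme is that elements are functions and not classes: an operator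
  domain need not be a literal vector space, so sums and limits are available only up to a choice of
  representative.\<close>

lemma borel_measurable_cnj [measurable (raw)]:
  "f \<in> borel_measurable M \<Longrightarrow> (\<lambda>x. cnj (f x)) \<in> borel_measurable M"
  by (rule borel_measurable_continuous_on[OF _]) (intro continuous_intros)

lemma L2_measurable: "f \<in> L2 M \<Longrightarrow> f \<in> borel_measurable M"
  by (simp add: L2_def)

lemma L2_square_integrable: "f \<in> L2 M \<Longrightarrow> integrable M (\<lambda>x. (cmod (f x))\<^sup>2)"
  by (simp add: L2_def)

lemma L2_dominated:
  assumes "g \<in> L2 M" "f \<in> borel_measurable M" "AE x in M. cmod (f x) \<le> C * cmod (g x)"
  shows "f \<in> L2 M"
proof -
  have "integrable M (\<lambda>x. (cmod (f x))\<^sup>2)"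
  proof (rule Bochner_Integration.integrable_bound)
    show "integrable M (\<lambda>x. C\<^sup>2 * (cmod (g x))\<^sup>2)"
      using L2_square_integrable[OF assms(1)] by simp
    show "(\<lambda>x. (cmod (f x))\<^sup>2) \<in> borel_measurable M"
      using assms(2) by measurable
    show "AE x in M. norm ((cmod (f x))\<^sup>2) \<le> norm (C\<^sup>2 * (cmod (g x))\<^sup>2)"
      using assms(3)
    proof eventually_elim
      case (elim x)
      have "(cmod (f x))\<^sup>2 \<le> (C * cmod (g x))\<^sup>2"
        by (rule power_mono[OF elim]) simp
      then show ?case by (simp add: power_mult_distrib)
    qed
  qed
  with assms(2) show ?thesis by (simp add: L2_def)
qed

lemma L2_integrable_mult:
  assumes "f \<in> L2 M" "g \<in> L2 M"
  shows "integrable M (\<lambda>x. f x * g x)"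
proof (rule Bochner_Integration.integrable_bound)
  show "integrable M (\<lambda>x. (cmod (f x))\<^sup>2 + (cmod (g x))\<^sup>2)"
    using assms by (simp add: L2_def)
  show "(\<lambda>x. f x * g x) \<in> borel_measurable M"
    using assms[THEN L2_measurable] by measurable
  have "cmod (f x) * cmod (g x) \<le> (cmod (f x))\<^sup>2 + (cmod (g x))\<^sup>2" for x
    using sum_squares_bound[of "cmod (f x)" "cmod (g x)"]
      mult_nonneg_nonneg[OF norm_ge_zero[of "f x"] norm_ge_zero[of "g x"]] by linarith
  then show "AE x in M. norm (f x * g x) \<le> norm ((cmod (f x))\<^sup>2 + (cmod (g x))\<^sup>2)"
    by (simp add: norm_mult)
qed

lemma L2_cnj: "f \<in> L2 M \<Longrightarrow> (\<lambda>x. cnj (f x)) \<in> L2 M"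
  by (simp add: L2_def borel_measurable_cnj)

lemma L2_integrable_inner:
  assumes "f \<in> L2 M" "g \<in> L2 M"
  shows "integrable M (\<lambda>x. f x * cnj (g x))"
  using L2_integrable_mult[OF assms(1) L2_cnj[OF assms(2)]] .

lemma L2_lincomb:
  assumes "f \<in> L2 M" "g \<in> L2 M"
  shows "(\<lambda>x. a * f x + b * g x) \<in> L2 M"
proof -
  have "integrable M (\<lambda>x. (cmod (a * f x + b * g x))\<^sup>2)"
  proof (rule Bochner_Integration.integrable_bound)
    show "integrable M (\<lambda>x. 2 * (cmod a)\<^sup>2 * (cmod (f x))\<^sup>2 + 2 * (cmod b)\<^sup>2 * (cmod (g x))\<^sup>2)"
      using assms by (simp add: L2_def)
    show "(\<lambda>x. (cmod (a * f x + b * g x))\<^sup>2) \<in> borel_measurable M"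
      using assms[THEN L2_measurable] by measurable
    have "(cmod (a * f x + b * g x))\<^sup>2 \<le>
        2 * (cmod a)\<^sup>2 * (cmod (f x))\<^sup>2 + 2 * (cmod b)\<^sup>2 * (cmod (g x))\<^sup>2" for x
    proof -
      have "(cmod (a * f x + b * g x))\<^sup>2 \<le> (cmod a * cmod (f x) + cmod b * cmod (g x))\<^sup>2"
        by (intro power_mono order.trans[OF norm_triangle_ineq]) (simp_all add: norm_mult)
      also have "\<dots> \<le> 2 * (cmod a * cmod (f x))\<^sup>2 + 2 * (cmod b * cmod (g x))\<^sup>2"
        using sum_squares_bound[of "cmod a * cmod (f x)" "cmod b * cmod (g x)"]
        by (simp add: power2_sum)
      finally show ?thesis by (simp add: power_mult_distrib)
    qed
    then show "AE x in M. norm ((cmod (a * f x + b * g x))\<^sup>2) \<le>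
        norm (2 * (cmod a)\<^sup>2 * (cmod (f x))\<^sup>2 + 2 * (cmod b)\<^sup>2 * (cmod (g x))\<^sup>2)"
      by simp
  qed
  moreover have "(\<lambda>x. a * f x + b * g x) \<in> borel_measurable M"
    using assms[THEN L2_measurable] by measurable
  ultimately show ?thesis by (simp add: L2_def)
qed

lemma L2_diff: "f \<in> L2 M \<Longrightarrow> g \<in> L2 M \<Longrightarrow> (\<lambda>x. f x - g x) \<in> L2 M"
  using L2_lincomb[of f M g 1 "-1"] by simp

lemma L2_scale: "f \<in> L2 M \<Longrightarrow> (\<lambda>x. a * f x) \<in> L2 M"
  using L2_lincomb[of f M f a 0] by simp

lemma L2_zero: "(\<lambda>x. 0) \<in> L2 M"
  by (simp add: L2_def)

lemma L2_inner_cong: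
  assumes "f \<in> L2 M" "f' \<in> L2 M" "g \<in> L2 M" "g' \<in> L2 M"
    and "AE x in M. f x = f' x" "AE x in M. g x = g' x"
  shows "L2_inner M f g = L2_inner M f' g'"
  unfolding L2_inner_def
proof (rule integral_cong_AE)
  show "AE x in M. f x * cnj (g x) = f' x * cnj (g' x)"
    using assms(5,6) by eventually_elim simp
qed (use assms(1-4)[THEN L2_measurable] in measurable)

lemma L2_norm_cong:
  assumes "f \<in> L2 M" "f' \<in> L2 M" "AE x in M. f x = f' x"
  shows "L2_norm M f = L2_norm M f'"
proof -
  have "(LINT x|M. (cmod (f x))\<^sup>2) = (LINT x|M. (cmod (f' x))\<^sup>2)"
  proof (rule integral_cong_AE)
    show "AE x in M. (cmod (f x))\<^sup>2 = (cmod (f' x))\<^sup>2"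
      using assms(3) by eventually_elim simp
  qed (use assms(1,2)[THEN L2_measurable] in measurable)
  then show ?thesis by (simp add: L2_norm_def)
qed

lemma L2_inner_cnj: "cnj (L2_inner M f g) = L2_inner M g f"
  unfolding L2_inner_def by (subst Bochner_Integration.integral_cnj[symmetric]) (simp add: mult.commute)

lemma L2_inner_lincomb_left:
  assumes "f \<in> L2 M" "g \<in> L2 M" "h \<in> L2 M"
  shows "L2_inner M (\<lambda>x. a * f x + b * g x) h = a * L2_inner M f h + b * L2_inner M g h"
  using L2_integrable_inner[OF assms(1,3)] L2_integrable_inner[OF assms(2,3)]
  by (simp add: L2_inner_def distrib_right mult.assoc)

lemma L2_inner_lincomb_right:
  assumes "f \<in> L2 M" "g \<in> L2 M" "h \<in> L2 M"
  shows "L2_inner M h (\<lambda>x. a * f x + b * g x) = cnj a * L2_inner M h f + cnj b * L2_inner M h g"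
  using arg_cong[OF L2_inner_lincomb_left[OF assms], of cnj] by (simp add: L2_inner_cnj)

lemma L2_inner_diff_left:
  assumes "f \<in> L2 M" "g \<in> L2 M" "h \<in> L2 M"
  shows "L2_inner M (\<lambda>x. f x - g x) h = L2_inner M f h - L2_inner M g h"
  using L2_inner_lincomb_left[OF assms, of 1 "-1"] by simp

lemma L2_norm_nonneg: "0 \<le> L2_norm M f"
  by (simp add: L2_norm_def)

lemma L2_norm_power2: "(L2_norm M f)\<^sup>2 = (LINT x|M. (cmod (f x))\<^sup>2)"
  by (simp add: L2_norm_def)

lemma L2_inner_self: "L2_inner M f f = of_real ((L2_norm M f)\<^sup>2)"
proof -
  have "L2_inner M f f = (LINT x|M. complex_of_real ((cmod (f x))\<^sup>2))"
    by (simp only: L2_inner_def complex_norm_square)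
  then show ?thesis by (simp only: L2_norm_power2 integral_complex_of_real)
qed

lemma L2_norm_eq_0:
  assumes "f \<in> L2 M" "L2_norm M f = 0"
  shows "AE x in M. f x = 0"
proof -
  have "AE x in M. (cmod (f x))\<^sup>2 = 0"
    using integral_nonneg_eq_0_iff_AE[OF L2_square_integrable[OF assms(1)]] assms(2)
      L2_norm_power2[of M f] by simp
  then show ?thesis by simp
qed

lemma L2_inner_zero_right:
  assumes "f \<in> L2 M" "g \<in> L2 M" "AE x in M. g x = 0"
  shows "L2_inner M f g = 0"
  using L2_inner_cong[OF assms(1,1,2) L2_zero _ assms(3)] by (simp add: L2_inner_def)

text \<open>The Cauchy-Schwarz and triangle inequalities, polarisation, the parallelogram law and
  the minimality argument for projections are all read off from this one expansion.\<close>

lemma L2_norm_power2_lincomb: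
  assumes "f \<in> L2 M" "g \<in> L2 M"
  shows "(L2_norm M (\<lambda>x. a * f x + b * g x))\<^sup>2 =
    (cmod a)\<^sup>2 * (L2_norm M f)\<^sup>2 + (cmod b)\<^sup>2 * (L2_norm M g)\<^sup>2 + 2 * Re (a * cnj b * L2_inner M f g)"
proof -
  let ?h = "\<lambda>x. a * f x + b * g x"
  have "complex_of_real ((L2_norm M ?h)\<^sup>2) =
    a * (cnj a * L2_inner M f f + cnj b * L2_inner M f g)
      + b * (cnj a * L2_inner M g f + cnj b * L2_inner M g g)"
    using assms L2_lincomb[OF assms]
    unfolding L2_inner_self[symmetric]
    by (simp only: L2_inner_lincomb_left L2_inner_lincomb_right)
  also have "\<dots> = of_real ((cmod a)\<^sup>2 * (L2_norm M f)\<^sup>2) + of_real ((cmod b)\<^sup>2 * (L2_norm M g)\<^sup>2)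
      + (a * cnj b * L2_inner M f g + cnj (a * cnj b * L2_inner M f g))"
    unfolding of_real_mult complex_norm_square L2_inner_self[symmetric]
    by (simp add: L2_inner_cnj algebra_simps)
  also have "\<dots> = of_real ((cmod a)\<^sup>2 * (L2_norm M f)\<^sup>2 + (cmod b)\<^sup>2 * (L2_norm M g)\<^sup>2
      + 2 * Re (a * cnj b * L2_inner M f g))"
    unfolding complex_add_cnj by (simp only: of_real_add)
  finally show ?thesis unfolding of_real_eq_iff .
qed

lemma L2_Cauchy_Schwarz:
  assumes "f \<in> L2 M" "g \<in> L2 M"
  shows "cmod (L2_inner M f g) \<le> L2_norm M f * L2_norm M g"
proof (cases "L2_norm M g = 0")
  case True
  then show ?thesis
    using L2_inner_zero_right[OF assms L2_norm_eq_0[OF assms(2)]] by simp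
next
  case False
  let ?c = "L2_inner M f g" and ?a = "L2_norm M f" and ?b = "L2_norm M g"
  \<comment> \<open>The vector is |g|^2 times the component of f orthogonal to g; scaling by |g|^2
    avoids a division.\<close>
  have "0 \<le> (L2_norm M (\<lambda>x. of_real (?b\<^sup>2) * f x + (- ?c) * g x))\<^sup>2" by simp
  also have "\<dots> = (?b\<^sup>2)\<^sup>2 * ?a\<^sup>2 + (cmod ?c)\<^sup>2 * ?b\<^sup>2
      + 2 * Re (of_real (?b\<^sup>2) * cnj (- ?c) * ?c)"
    unfolding L2_norm_power2_lincomb[OF assms] by (simp add: norm_power)
  also have "of_real (?b\<^sup>2) * cnj (- ?c) * ?c = - (of_real (?b\<^sup>2 * (cmod ?c)\<^sup>2))"
    unfolding of_real_mult complex_norm_square by simp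
  finally have "0 \<le> ?b\<^sup>2 * (?b\<^sup>2 * ?a\<^sup>2 - (cmod ?c)\<^sup>2)"
    by (simp add: algebra_simps power2_eq_square)
  then have "(cmod ?c)\<^sup>2 \<le> (?a * ?b)\<^sup>2"
    using False by (simp add: zero_le_mult_iff power_mult_distrib mult.commute)
  then show ?thesis
    by (rule power2_le_imp_le) (simp add: L2_norm_nonneg)
qed

lemma L2_norm_triangle:
  assumes "f \<in> L2 M" "g \<in> L2 M"
  shows "L2_norm M (\<lambda>x. f x + g x) \<le> L2_norm M f + L2_norm M g"
proof (rule power2_le_imp_le)
  have "Re (L2_inner M f g) \<le> L2_norm M f * L2_norm M g"
    by (rule order.trans[OF complex_Re_le_cmod L2_Cauchy_Schwarz[OF assms]])
  then show "(L2_norm M (\<lambda>x. f x + g x))\<^sup>2 \<le> (L2_norm M f + L2_norm M g)\<^sup>2"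
    using L2_norm_power2_lincomb[OF assms, of 1 1] by (simp add: power2_sum)
qed (simp add: L2_norm_nonneg)

lemma L2_norm_minus_commute: "L2_norm M (\<lambda>x. f x - g x) = L2_norm M (\<lambda>x. g x - f x)"
  by (simp add: L2_norm_def norm_minus_commute)

section \<open>Limits in norm, truncation and bounded operators\<close>

lemma L2_inner_tendsto_left:
  assumes s: "\<And>n. s n \<in> L2 M" and f: "f \<in> L2 M" and h: "h \<in> L2 M"
    and lim: "(\<lambda>n. L2_norm M (\<lambda>x. s n x - f x)) \<longlonglongrightarrow> 0"
  shows "(\<lambda>n. L2_inner M (s n) h) \<longlonglongrightarrow> L2_inner M f h"
proof (rule Lim_transform_bound[THEN LIM_zero_cancel])
  show "\<forall>\<^sub>F n in sequentially. norm (L2_inner M (s n) h - L2_inner M f h)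
      \<le> norm (L2_norm M (\<lambda>x. s n x - f x) * L2_norm M h)"
    using L2_Cauchy_Schwarz[OF L2_diff[OF s f] h]
    by (simp add: L2_inner_diff_left[OF s f h] L2_norm_nonneg)
  show "(\<lambda>n. L2_norm M (\<lambda>x. s n x - f x) * L2_norm M h) \<longlonglongrightarrow> 0"
    using tendsto_mult_left_zero[OF lim] .
qed

lemma L2_inner_tendsto_right:
  assumes "\<And>n. s n \<in> L2 M" "f \<in> L2 M" "h \<in> L2 M"
    and "(\<lambda>n. L2_norm M (\<lambda>x. s n x - f x)) \<longlonglongrightarrow> 0"
  shows "(\<lambda>n. L2_inner M h (s n)) \<longlonglongrightarrow> L2_inner M h f"
  using tendsto_cnj[OF L2_inner_tendsto_left[OF assms]] by (simp add: L2_inner_cnj)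

text \<open>Dominated convergence with majorant |f|^2. It serves both sides: compact subintervals
  exhausting the interval, and cut-offs in the spectral variable.\<close>

lemma L2_truncation_tendsto:
  assumes f: "f \<in> L2 M" and P: "\<And>n. {x \<in> space M. P n x} \<in> sets M"
    and ev: "\<And>x. x \<in> space M \<Longrightarrow> \<forall>\<^sub>F n in sequentially. P n x"
  shows "(\<lambda>n. L2_norm M (\<lambda>x. (if P n x then f x else 0) - f x)) \<longlonglongrightarrow> 0"
proof -
  have [measurable]: "f \<in> borel_measurable M" "\<And>n. Measurable.pred M (P n)"
    using L2_measurable[OF f] P by (auto simp: pred_def)
  have "(\<lambda>n. LINT x|M. (cmod ((if P n x then f x else 0) - f x))\<^sup>2) \<longlonglongrightarrow> (LINT x|M. 0)"
  proof (rule integral_dominated_convergence)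
    show "integrable M (\<lambda>x. (cmod (f x))\<^sup>2)" using L2_square_integrable[OF f] .
    show "AE x in M. (\<lambda>n. (cmod ((if P n x then f x else 0) - f x))\<^sup>2) \<longlonglongrightarrow> 0"
    proof (rule AE_I2)
      fix x assume "x \<in> space M"
      from ev[OF this] have "\<forall>\<^sub>F n in sequentially. (cmod ((if P n x then f x else 0) - f x))\<^sup>2 = 0"
        by eventually_elim simp
      then show "(\<lambda>n. (cmod ((if P n x then f x else 0) - f x))\<^sup>2) \<longlonglongrightarrow> 0"
        by (rule tendsto_eventually)
    qed
  qed auto
  then show ?thesis
    unfolding L2_norm_def using tendsto_real_sqrt by fastforce
qed

lemma L2_linear_diff:
  assumes F: "L2_linear M N F" and f: "f \<in> L2 M" "g \<in> L2 M"
  shows "AE y in N. F (\<lambda>x. f x - g x) y = F f y - F g y"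
proof -
  have "AE y in N. F (\<lambda>x. 1 * f x + (-1) * g x) y = 1 * F f y + (-1) * F g y"
    using F f unfolding L2_linear_def by blast
  then show ?thesis by simp
qed

lemma L2_bounded_linear_tendsto:
  assumes F: "L2_bounded_linear M N F" and s: "\<And>n. s n \<in> L2 M" and f: "f \<in> L2 M"
    and lim: "(\<lambda>n. L2_norm M (\<lambda>x. s n x - f x)) \<longlonglongrightarrow> 0"
  shows "(\<lambda>n. L2_norm N (\<lambda>x. F (s n) x - F f x)) \<longlonglongrightarrow> 0"
proof -
  have lin: "L2_linear M N F" and mem: "\<And>f. f \<in> L2 M \<Longrightarrow> F f \<in> L2 N"
    using F by (auto simp: L2_bounded_linear_def L2_linear_def)
  obtain C where C: "\<And>f. f \<in> L2 M \<Longrightarrow> L2_norm N (F f) \<le> C * L2_norm M f"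
    using F by (auto simp: L2_bounded_linear_def)
  have "L2_norm N (\<lambda>x. F (s n) x - F f x) \<le> C * L2_norm M (\<lambda>x. s n x - f x)" for n
    using L2_norm_cong[OF _ _ L2_linear_diff[OF lin s f]] C[OF L2_diff[OF s f]]
    by (simp add: mem L2_diff s f)
  then show ?thesis
    by (intro Lim_null_comparison[OF _ tendsto_mult_right_zero[OF lim, of C]])
      (auto simp: L2_norm_nonneg)
qed

lemma L2_isometry_imp_bounded_linear: "L2_isometry M N F \<Longrightarrow> L2_bounded_linear M N F"
  unfolding L2_isometry_def L2_bounded_linear_def by (metis mult_1 order_refl)

lemma L2_isometry_inner:
  assumes F: "L2_isometry M N F" and f: "f \<in> L2 M" and g: "g \<in> L2 M"
  shows "L2_inner N (F f) (F g) = L2_inner M f g"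
proof -
  have mem: "\<And>f. f \<in> L2 M \<Longrightarrow> F f \<in> L2 N"
    and iso: "\<And>f. f \<in> L2 M \<Longrightarrow> L2_norm N (F f) = L2_norm M f"
    and lin: "\<And>a b. AE y in N. F (\<lambda>x. a * f x + b * g x) y = a * F f y + b * F g y"
    using F f g by (auto simp: L2_isometry_def L2_linear_def)
  \<comment> \<open>Polarisation: comparing the norms of f + b g and of its image isolates this real
    part. The value b = 1 gives the real part of the inner product and b = i its imaginary
    part.\<close>
  have "Re (cnj b * L2_inner N (F f) (F g)) = Re (cnj b * L2_inner M f g)" for b
  proof -
    have "L2_norm N (\<lambda>y. 1 * F f y + b * F g y) = L2_norm N (F (\<lambda>x. 1 * f x + b * g x))"
      using lin[of 1 b] by (intro L2_norm_cong L2_lincomb mem f g) (auto elim: eventually_mono)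
    also have "\<dots> = L2_norm M (\<lambda>x. 1 * f x + b * g x)"
      by (intro iso L2_lincomb f g)
    finally have "(L2_norm N (\<lambda>y. 1 * F f y + b * F g y))\<^sup>2 = (L2_norm M (\<lambda>x. 1 * f x + b * g x))\<^sup>2"
      by simp
    then show ?thesis
      unfolding L2_norm_power2_lincomb[OF f g] L2_norm_power2_lincomb[OF mem[OF f] mem[OF g]]
      by (simp add: iso f g)
  qed
  from this[of 1] this[of \<i>] show ?thesis by (simp add: complex_eq_iff)
qed

section \<open>Completeness and orthogonal projection\<close>

text \<open>Riesz-Fischer: a rapidly Cauchy subsequence converges almost everywhere, and Fatou's
  lemma turns this pointwise limit into a limit in norm of the whole sequence.\<close>

lemma L2_complete:
  assumes s: "\<And>n. s n \<in> L2 M"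
    and Cauchy: "\<And>\<epsilon>. 0 < \<epsilon> \<Longrightarrow> \<exists>N. \<forall>m\<ge>N. \<forall>n\<ge>N. L2_norm M (\<lambda>x. s m x - s n x) < \<epsilon>"
  obtains f where "f \<in> L2 M" "(\<lambda>n. L2_norm M (\<lambda>x. s n x - f x)) \<longlonglongrightarrow> 0"
proof -
  have [measurable]: "s n \<in> borel_measurable M" for n
    using L2_measurable[OF s] .
  have norm_nn: "(\<integral>\<^sup>+x. ennreal ((cmod (h x))\<^sup>2) \<partial>M) = ennreal ((L2_norm M h)\<^sup>2)" if "h \<in> L2 M" for h
    unfolding L2_norm_power2 by (rule nn_integral_eq_integral) (use L2_square_integrable[OF that] in auto)
  obtain N where N: "L2_norm M (\<lambda>x. s m x - s n x) < (1/2)^k" if "m \<ge> N k" "n \<ge> N k" for k m n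
    using Cauchy[of "(1/2)^k" for k] by (metis zero_less_divide_1_iff zero_less_numeral zero_less_power)
  \<comment> \<open>The maximum makes \<open>r\<close> strictly increasing while keeping
    \<open>r k\<close> beyond the threshold \<open>N k\<close>.\<close>
  define r where "r = rec_nat (N 0) (\<lambda>k i. max (Suc i) (N (Suc k)))"
  have r_N: "N k \<le> r k" for k by (cases k) (auto simp: r_def)
  have "strict_mono r" by (rule strict_monoI_Suc) (auto simp: r_def less_max_iff_disj)
  define \<Delta> where "\<Delta> k x = s (r (Suc k)) x - s (r k) x" for k x
  have [measurable]: "\<Delta> k \<in> borel_measurable M" for k unfolding \<Delta>_def by measurable
  have \<Delta>_L2: "\<Delta> k \<in> L2 M" for k unfolding \<Delta>_def by (intro L2_diff s)
  have \<Delta>_norm: "(L2_norm M (\<Delta> k))\<^sup>2 \<le> (1/4)^k" for k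
  proof -
    have "L2_norm M (\<Delta> k) < (1/2)^k"
      unfolding \<Delta>_def using r_N[of k] strict_monoD[OF \<open>strict_mono r\<close>, of k "Suc k"]
      by (intro N) auto
    then have "(L2_norm M (\<Delta> k))\<^sup>2 \<le> ((1/2)^k)\<^sup>2"
      by (intro power_mono) (auto simp: L2_norm_nonneg)
    also have "\<dots> = (1/4::real)^k"
      unfolding power_mult[symmetric] mult.commute[of k] by (simp add: power_mult power2_eq_square)
    finally show ?thesis .
  qed
  \<comment> \<open>The squared norms are at most \<open>(1/4)^k\<close>, so the weight
    \<open>2^k\<close> still leaves a convergent series. Its finiteness at x bounds the increments
    there by a multiple of \<open>sqrt (1/2) ^ k\<close>, which is summable; no triangle inequality
    for infinite sums is required.\<close>
  have "(\<integral>\<^sup>+x. (\<Sum>k. ennreal (2^k * (cmod (\<Delta> k x))\<^sup>2)) \<partial>M)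
      = (\<Sum>k. \<integral>\<^sup>+x. ennreal (2^k * (cmod (\<Delta> k x))\<^sup>2) \<partial>M)"
    by (rule nn_integral_suminf) simp
  also have "\<dots> = (\<Sum>k. ennreal (2^k * (L2_norm M (\<Delta> k))\<^sup>2))"
    by (simp add: ennreal_mult nn_integral_cmult norm_nn[OF \<Delta>_L2])
  also have "\<dots> \<le> (\<Sum>k. ennreal ((1/2)^k))"
  proof (intro suminf_le ennreal_leI)
    fix k
    have "2^k * (L2_norm M (\<Delta> k))\<^sup>2 \<le> 2^k * (1/4)^k" using \<Delta>_norm[of k] by simp
    also have "\<dots> = (1/2::real)^k" by (simp flip: power_mult_distrib)
    finally show "2^k * (L2_norm M (\<Delta> k))\<^sup>2 \<le> (1/2)^k" .
  qed auto
  also have "\<dots> < \<infinity>"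
    by (subst suminf_ennreal2) (auto intro!: summable_geometric)
  finally have "AE x in M. (\<Sum>k. ennreal (2^k * (cmod (\<Delta> k x))\<^sup>2)) \<noteq> \<infinity>"
    by (intro nn_integral_PInf_AE) auto
  then have conv: "AE x in M. convergent (\<lambda>k. s (r k) x)"
  proof eventually_elim
    case (elim x)
    then have "summable (\<lambda>k. 2^k * (cmod (\<Delta> k x))\<^sup>2)"
      by (intro summable_suminf_not_top) auto
    then have "bounded (range (\<lambda>k. 2^k * (cmod (\<Delta> k x))\<^sup>2))"
      by (rule convergent_imp_bounded[OF summable_LIMSEQ_zero])
    then obtain B where B: "norm (2^k * (cmod (\<Delta> k x))\<^sup>2) \<le> B" for k
      by (auto simp: bounded_iff)
    have "cmod (\<Delta> k x) \<le> sqrt B * sqrt (1/2) ^ k" for k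
    proof -
      have "(cmod (\<Delta> k x))\<^sup>2 \<le> B * (1/2)^k"
        using B[of k] by (simp add: field_simps power_divide)
      then have "cmod (\<Delta> k x) \<le> sqrt (B * (1/2)^k)" by (rule real_le_rsqrt)
      then show ?thesis by (simp add: real_sqrt_mult real_sqrt_power)
    qed
    moreover have "summable (\<lambda>k. sqrt B * sqrt (1/2) ^ k)"
      by (intro summable_mult summable_geometric) simp
    ultimately have "summable (\<lambda>k. \<Delta> k x)"
      using summable_comparison_test'[of "\<lambda>k. sqrt B * sqrt (1/2) ^ k" 0 "\<lambda>k. \<Delta> k x"] by blast
    then have "convergent (\<lambda>n. \<Sum>k<n. s (r (Suc k)) x - s (r k) x)"
      unfolding \<Delta>_def summable_iff_convergent .
    then have "convergent (\<lambda>n. s (r n) x - s (r 0) x)"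
      by (simp add: sum_lessThan_telescope[of "\<lambda>k. s (r k) x"])
    from convergent_add[OF this convergent_const[of "s (r 0) x"]] show ?case by simp
  qed
  define f where "f x = lim (\<lambda>k. s (r k) x)" for x
  have [measurable]: "f \<in> borel_measurable M" unfolding f_def by measurable
  have f_lim: "AE x in M. (\<lambda>k. s (r k) x) \<longlonglongrightarrow> f x"
    using conv unfolding f_def convergent_LIMSEQ_iff .
  \<comment> \<open>Fatou along the subsequence: a bound on the distance from s m to all late terms
    passes to the limit f. It is used once with bound 1 to place f in L2, and once with a small
    bound for convergence.\<close>
  have near: "(\<integral>\<^sup>+x. ennreal ((cmod (s m x - f x))\<^sup>2) \<partial>M) \<le> ennreal (\<epsilon>\<^sup>2)"
    if \<epsilon>: "\<And>n. n \<ge> K \<Longrightarrow> L2_norm M (\<lambda>x. s m x - s n x) \<le> \<epsilon>" for m K \<epsilon>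
  proof -
    have "(\<integral>\<^sup>+x. ennreal ((cmod (s m x - f x))\<^sup>2) \<partial>M)
      \<le> (\<integral>\<^sup>+x. liminf (\<lambda>k. ennreal ((cmod (s m x - s (r k) x))\<^sup>2)) \<partial>M)"
    proof (rule nn_integral_mono_AE)
      show "AE x in M. ennreal ((cmod (s m x - f x))\<^sup>2)
          \<le> liminf (\<lambda>k. ennreal ((cmod (s m x - s (r k) x))\<^sup>2))"
        using f_lim
      proof eventually_elim
        case (elim x)
        have "(\<lambda>k. ennreal ((cmod (s m x - s (r k) x))\<^sup>2)) \<longlonglongrightarrow> ennreal ((cmod (s m x - f x))\<^sup>2)"
          by (intro tendsto_intros elim)
        from lim_imp_Liminf[OF sequentially_bot this] show ?case by simp
      qed
    qed
    also have "\<dots> \<le> liminf (\<lambda>k. \<integral>\<^sup>+x. ennreal ((cmod (s m x - s (r k) x))\<^sup>2) \<partial>M)"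
      by (rule nn_integral_liminf) simp
    also have "\<dots> \<le> liminf (\<lambda>k. ennreal (\<epsilon>\<^sup>2))"
    proof (rule Liminf_mono)
      show "\<forall>\<^sub>F k in sequentially. (\<integral>\<^sup>+x. ennreal ((cmod (s m x - s (r k) x))\<^sup>2) \<partial>M) \<le> ennreal (\<epsilon>\<^sup>2)"
        using eventually_ge_at_top[of K]
      proof eventually_elim
        case (elim k)
        then have "L2_norm M (\<lambda>x. s m x - s (r k) x) \<le> \<epsilon>"
          using seq_suble[OF \<open>strict_mono r\<close>, of k] by (intro \<epsilon>) auto
        then show ?case
          unfolding norm_nn[OF L2_diff[OF s s]] by (intro ennreal_leI power_mono) (auto simp: L2_norm_nonneg)
      qed
    qed
    finally show ?thesis by (simp add: Liminf_const)
  qed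
  have diff: "(\<lambda>x. s m x - f x) \<in> L2 M" if "m \<ge> N 0" for m
  proof -
    have "(\<integral>\<^sup>+x. ennreal ((cmod (s m x - f x))\<^sup>2) \<partial>M) \<le> ennreal (1\<^sup>2)"
      using N[of 0 m] that by (intro near[of "N 0"]) (auto intro: less_imp_le)
    then have "integrable M (\<lambda>x. (cmod (s m x - f x))\<^sup>2)"
      by (intro integrableI_bounded) (auto simp: le_less_trans)
    then show ?thesis by (simp add: L2_def)
  qed
  have "(\<lambda>x. s (N 0) x - (s (N 0) x - f x)) \<in> L2 M"
    by (intro L2_diff s diff) simp
  then have f: "f \<in> L2 M" by simp
  have "(\<lambda>n. L2_norm M (\<lambda>x. s n x - f x)) \<longlonglongrightarrow> 0"
  proof (rule LIMSEQ_I)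
    fix \<epsilon> :: real assume "0 < \<epsilon>"
    then obtain K where K: "\<And>m n. m \<ge> K \<Longrightarrow> n \<ge> K \<Longrightarrow> L2_norm M (\<lambda>x. s m x - s n x) < \<epsilon> / 2"
      using Cauchy[of "\<epsilon> / 2"] by auto
    have "norm (L2_norm M (\<lambda>x. s m x - f x) - 0) < \<epsilon>" if "m \<ge> K" for m
    proof -
      have "ennreal ((L2_norm M (\<lambda>x. s m x - f x))\<^sup>2) \<le> ennreal ((\<epsilon> / 2)\<^sup>2)"
        unfolding norm_nn[OF L2_diff[OF s f], symmetric]
        by (rule near[of K]) (use K[OF that] in \<open>auto intro: less_imp_le\<close>)
      then have "L2_norm M (\<lambda>x. s m x - f x) \<le> \<epsilon> / 2"
        using \<open>0 < \<epsilon>\<close> by (simp add: power2_le_iff_abs_le L2_norm_nonneg)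
      then show ?thesis using \<open>0 < \<epsilon>\<close> by (simp add: L2_norm_nonneg)
    qed
    then show "\<exists>no. \<forall>n\<ge>no. norm (L2_norm M (\<lambda>x. s n x - f x) - 0) < \<epsilon>" by blast
  qed
  with f that show ?thesis by blast
qed

text \<open>The nearest point of a closed subspace, found as the limit of a minimising sequence.
  Subspace and closedness are hypotheses on a set of functions, so that the range of an operator,
  taken with all its representatives, can be substituted.\<close>

lemma L2_projection:
  assumes R: "R \<subseteq> L2 M" "R \<noteq> {}"
    and lin: "\<And>y w a b. y \<in> R \<Longrightarrow> w \<in> R \<Longrightarrow> (\<lambda>x. a * y x + b * w x) \<in> R"
    and closed: "\<And>s y. (\<And>n. s n \<in> R) \<Longrightarrow> y \<in> L2 M \<Longrightarrow>
      (\<lambda>n. L2_norm M (\<lambda>x. s n x - y x)) \<longlonglongrightarrow> 0 \<Longrightarrow> y \<in> R"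
    and f: "f \<in> L2 M"
  obtains y where "y \<in> R" "\<And>w. w \<in> R \<Longrightarrow> L2_inner M (\<lambda>x. f x - y x) w = 0"
proof -
  define D where "D = (\<lambda>y. (L2_norm M (\<lambda>x. f x - y x))\<^sup>2) ` R"
  have D: "D \<noteq> {}" "bdd_below D" using R(2) by (auto simp: D_def intro!: bdd_belowI2[where m = 0])
  define d where "d = Inf D"
  have d_le: "d \<le> (L2_norm M (\<lambda>x. f x - y x))\<^sup>2" if "y \<in> R" for y
    unfolding d_def by (rule cInf_lower[OF _ D(2)]) (auto simp: D_def that)
  have "\<exists>y\<in>R. (L2_norm M (\<lambda>x. f x - y x))\<^sup>2 < d + inverse (real (Suc n))" for n
    using cInf_lessD[OF D(1), of "d + inverse (real (Suc n))"] by (auto simp: d_def D_def)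
  then obtain s where sR: "\<And>n. s n \<in> R"
    and s_d: "\<And>n. (L2_norm M (\<lambda>x. f x - s n x))\<^sup>2 < d + inverse (real (Suc n))" by metis
  have s: "s n \<in> L2 M" for n using sR R(1) by auto
  \<comment> \<open>Parallelogram law: the midpoint of s m and s n is again in \<open>R\<close>,
    hence at squared distance at least \<open>d\<close> from f, which forces the two points
    together.\<close>
  have par: "(L2_norm M (\<lambda>x. s m x - s n x))\<^sup>2 \<le> 2 * inverse (real (Suc m)) + 2 * inverse (real (Suc n))" for m n
  proof -
    let ?u = "\<lambda>x. f x - s m x" and ?v = "\<lambda>x. f x - s n x"
    have uv: "?u \<in> L2 M" "?v \<in> L2 M" by (intro L2_diff f s)+
    have mid: "d \<le> (L2_norm M (\<lambda>x. 1/2 * ?u x + 1/2 * ?v x))\<^sup>2"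
    proof -
      have "(\<lambda>x. 1/2 * ?u x + 1/2 * ?v x) = (\<lambda>x. f x - (1/2 * s m x + 1/2 * s n x))"
        by (rule ext) (simp add: algebra_simps)
      then show ?thesis using d_le[OF lin[OF sR[of m] sR[of n], of "1/2" "1/2"]] by simp
    qed
    have "(L2_norm M (\<lambda>x. s m x - s n x))\<^sup>2 = (L2_norm M (\<lambda>x. (-1) * ?u x + 1 * ?v x))\<^sup>2"
      by simp
    then show ?thesis
      using mid s_d[of m] s_d[of n]
      unfolding L2_norm_power2_lincomb[OF uv] by (simp add: power2_eq_square)
  qed
  obtain y where y: "y \<in> L2 M" and lim: "(\<lambda>n. L2_norm M (\<lambda>x. s n x - y x)) \<longlonglongrightarrow> 0"
  proof (rule L2_complete[of s M])
    fix \<epsilon> :: real assume "0 < \<epsilon>"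
    then obtain N where N: "inverse (real (Suc N)) < \<epsilon>\<^sup>2 / 4"
      using reals_Archimedean[of "\<epsilon>\<^sup>2 / 4"] by auto
    have "L2_norm M (\<lambda>x. s m x - s n x) < \<epsilon>" if "m \<ge> N" "n \<ge> N" for m n
    proof (rule power2_less_imp_less)
      have "inverse (real (Suc m)) \<le> inverse (real (Suc N))" "inverse (real (Suc n)) \<le> inverse (real (Suc N))"
        using that by (auto intro!: le_imp_inverse_le)
      then show "(L2_norm M (\<lambda>x. s m x - s n x))\<^sup>2 < \<epsilon>\<^sup>2" using par[of m n] N by linarith
    qed (use \<open>0 < \<epsilon>\<close> in simp)
    then show "\<exists>N. \<forall>m\<ge>N. \<forall>n\<ge>N. L2_norm M (\<lambda>x. s m x - s n x) < \<epsilon>" by blast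
  qed (use s in auto)
  have yR: "y \<in> R" by (rule closed[OF sR y lim])
  let ?e = "\<lambda>x. f x - y x"
  have e: "?e \<in> L2 M" by (rule L2_diff[OF f y])
  have e_d: "(L2_norm M ?e)\<^sup>2 \<le> d"
  proof (rule LIMSEQ_le)
    have "(\<lambda>n. L2_norm M (\<lambda>x. f x - s n x)) \<longlonglongrightarrow> L2_norm M ?e"
    proof (rule LIM_zero_cancel, rule Lim_null_comparison[OF _ lim], intro always_eventually allI)
      fix n
      have "L2_norm M (\<lambda>x. f x - s n x) \<le> L2_norm M ?e + L2_norm M (\<lambda>x. y x - s n x)"
        using L2_norm_triangle[OF e L2_diff[OF y s[of n]]] by simp
      moreover have "L2_norm M ?e \<le> L2_norm M (\<lambda>x. f x - s n x) + L2_norm M (\<lambda>x. s n x - y x)"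
        using L2_norm_triangle[OF L2_diff[OF f s[of n]] L2_diff[OF s[of n] y]] by simp
      ultimately show "norm (L2_norm M (\<lambda>x. f x - s n x) - L2_norm M ?e) \<le> L2_norm M (\<lambda>x. s n x - y x)"
        using L2_norm_minus_commute[of M y "s n"] by auto
    qed
    then show "(\<lambda>n. (L2_norm M (\<lambda>x. f x - s n x))\<^sup>2) \<longlonglongrightarrow> (L2_norm M ?e)\<^sup>2"
      by (rule tendsto_power)
    show "(\<lambda>n. d + inverse (real (Suc n))) \<longlonglongrightarrow> d"
      using tendsto_add[OF tendsto_const LIMSEQ_inverse_real_of_nat, of d] by simp
  qed (use s_d in \<open>auto intro: less_imp_le\<close>)
  have "L2_inner M ?e w = 0" if w: "w \<in> R" for w
  proof -
    have wL: "w \<in> L2 M" using w R(1) by auto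
    let ?c = "L2_inner M ?e w"
    \<comment> \<open>Moving \<open>y\<close> by t <e, w> w stays in \<open>R\<close>. The added 1
      keeps t defined when w has norm 0 and ensures t |w|^2 <= 1, so the move would shorten e unless
      <e, w> = 0.\<close>
    define t where "t = inverse (1 + (L2_norm M w)\<^sup>2)"
    have pos: "0 < 1 + (L2_norm M w)\<^sup>2" by (simp add: add_pos_nonneg)
    have "(L2_norm M ?e)\<^sup>2 \<le> (L2_norm M (\<lambda>x. f x - (1 * y x + (of_real t * ?c) * w x)))\<^sup>2"
      using e_d d_le[OF lin[OF yR w]] by (rule order.trans)
    also have "\<dots> = (L2_norm M (\<lambda>x. 1 * ?e x + (- of_real t * ?c) * w x))\<^sup>2"
      by (simp add: algebra_simps)
    also have "\<dots> = (L2_norm M ?e)\<^sup>2 + t\<^sup>2 * (cmod ?c)\<^sup>2 * (L2_norm M w)\<^sup>2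
        + 2 * Re (1 * cnj (- of_real t * ?c) * ?c)"
      unfolding L2_norm_power2_lincomb[OF e wL] by (simp add: norm_mult power_mult_distrib)
    also have "1 * cnj (- of_real t * ?c) * ?c = of_real (- t * (cmod ?c)\<^sup>2)"
      unfolding of_real_mult complex_norm_square by simp
    finally have "0 \<le> (cmod ?c)\<^sup>2 * (t * (t * (L2_norm M w)\<^sup>2 - 2))"
      by (simp add: algebra_simps power2_eq_square)
    moreover have "t * (t * (L2_norm M w)\<^sup>2 - 2) < 0"
    proof (rule mult_pos_neg)
      show "0 < t" using pos by (simp add: t_def)
      have "t * (L2_norm M w)\<^sup>2 \<le> 1" using pos by (simp add: t_def field_simps)
      then show "t * (L2_norm M w)\<^sup>2 - 2 < 0" by simp
    qed
    ultimately show ?thesis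
      using mult_pos_neg[of "(cmod ?c)\<^sup>2" "t * (t * (L2_norm M w)\<^sup>2 - 2)"]
      by (metis not_le zero_less_norm_iff zero_less_power)
  qed
  with yR that show ?thesis by blast
qed

section \<open>Resolvents of self-adjoint operators\<close>

lemma self_adjoint_operatorD:
  assumes "self_adjoint_operator M D A"
  shows "f \<in> D \<Longrightarrow> f \<in> L2 M" "f \<in> D \<Longrightarrow> A f \<in> L2 M"
  using assms by (auto simp: self_adjoint_operator_def)

lemma self_adjoint_symmetric:
  assumes sa: "self_adjoint_operator M D A" and f: "f \<in> D" and g: "g \<in> D"
  shows "L2_inner M (A f) g = L2_inner M f (A g)"
proof -
  have "\<exists>g'\<in>D. (AE x in M. g' x = g x) \<and> (AE x in M. A g' x = A g x)"
    using g by auto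
  then show ?thesis
    using sa f self_adjoint_operatorD[OF sa g] unfolding self_adjoint_operator_def by blast
qed

text \<open>This half of self-adjointness is the means of producing elements of the domain: verify
  the adjoint relation and receive a representative in \<open>D\<close>, equal to g only almost
  everywhere.\<close>

lemma self_adjoint_adjoint_domain:
  assumes sa: "self_adjoint_operator M D A" and "g \<in> L2 M" "h \<in> L2 M"
    and "\<And>f. f \<in> D \<Longrightarrow> L2_inner M (A f) g = L2_inner M f h"
  obtains g' where "g' \<in> D" "AE x in M. g' x = g x" "AE x in M. A g' x = h x"
  using assms unfolding self_adjoint_operator_def by blast

text \<open>Linearity is not part of the definition of an operator. It holds modulo null sets
  because the graph coincides with that of the adjoint, and an adjoint graph is always
  linear.\<close>

lemma self_adjoint_lincomb:
  assumes sa: "self_adjoint_operator M D A" and g: "g \<in> D" and h: "h \<in> D"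
  obtains u where "u \<in> D" "AE x in M. u x = a * g x + b * h x"
    "AE x in M. A u x = a * A g x + b * A h x"
proof (rule self_adjoint_adjoint_domain[OF sa])
  note mem = self_adjoint_operatorD[OF sa]
  show "(\<lambda>x. a * g x + b * h x) \<in> L2 M" "(\<lambda>x. a * A g x + b * A h x) \<in> L2 M"
    by (intro L2_lincomb mem g h)+
  fix f assume f: "f \<in> D"
  show "L2_inner M (A f) (\<lambda>x. a * g x + b * h x) = L2_inner M f (\<lambda>x. a * A g x + b * A h x)"
    using f g h by (simp add: L2_inner_lincomb_right mem self_adjoint_symmetric[OF sa])
qed

text \<open>Symmetry makes <A g, g> real, so only the shift by z contributes.\<close>

lemma self_adjoint_Im_inner:
  assumes sa: "self_adjoint_operator M D A" and g: "g \<in> D"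
  shows "Im (L2_inner M (\<lambda>x. A g x - z * g x) g) = - Im z * (L2_norm M g)\<^sup>2"
proof -
  note mem = self_adjoint_operatorD[OF sa g]
  have "cnj (L2_inner M (A g) g) = L2_inner M (A g) g"
    by (simp add: L2_inner_cnj self_adjoint_symmetric[OF sa g g])
  then have "Im (L2_inner M (A g) g) = 0"
    by (simp add: complex_eq_iff)
  moreover have "L2_inner M (\<lambda>x. A g x - z * g x) g = L2_inner M (A g) g - z * L2_inner M g g"
    using L2_inner_lincomb_left[OF mem(2,1,1), of 1 "- z"] by simp
  ultimately show ?thesis by (simp add: L2_inner_self)
qed

lemma self_adjoint_lower_bound:
  assumes sa: "self_adjoint_operator M D A" and g: "g \<in> D"
  shows "\<bar>Im z\<bar> * L2_norm M g \<le> L2_norm M (\<lambda>x. A g x - z * g x)"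
proof (cases "L2_norm M g = 0")
  case False
  note mem = self_adjoint_operatorD[OF sa g]
  have "\<bar>Im z\<bar> * (L2_norm M g)\<^sup>2 = \<bar>Im (L2_inner M (\<lambda>x. A g x - z * g x) g)\<bar>"
    by (simp add: self_adjoint_Im_inner[OF sa g] abs_mult)
  also have "\<dots> \<le> cmod (L2_inner M (\<lambda>x. A g x - z * g x) g)"
    by (rule abs_Im_le_cmod)
  also have "\<dots> \<le> L2_norm M (\<lambda>x. A g x - z * g x) * L2_norm M g"
    by (intro L2_Cauchy_Schwarz L2_diff L2_scale mem)
  finally show ?thesis
    using False L2_norm_nonneg[of M g] by (simp add: power2_eq_square flip: mult.assoc)
qed (simp add: L2_norm_nonneg)

text \<open>The pointwise difference of two elements of \<open>D\<close> need not lie in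
  \<open>D\<close>, so the lower bound is applied to a representative of it.\<close>

lemma self_adjoint_lower_bound_diff:
  assumes sa: "self_adjoint_operator M D A" and g: "g \<in> D" and h: "h \<in> D"
  shows "\<bar>Im z\<bar> * L2_norm M (\<lambda>x. g x - h x)
    \<le> L2_norm M (\<lambda>x. (A g x - z * g x) - (A h x - z * h x))"
proof -
  note mem = self_adjoint_operatorD[OF sa]
  obtain u where u: "u \<in> D" "AE x in M. u x = 1 * g x + (-1) * h x"
    "AE x in M. A u x = 1 * A g x + (-1) * A h x"
    by (rule self_adjoint_lincomb[OF sa g h])
  have "L2_norm M u = L2_norm M (\<lambda>x. g x - h x)"
    using u(2) by (intro L2_norm_cong L2_diff mem u(1) g h) simp
  moreover have "L2_norm M (\<lambda>x. A u x - z * u x) = L2_norm M (\<lambda>x. (A g x - z * g x) - (A h x - z * h x))"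
  proof (intro L2_norm_cong L2_diff L2_scale mem(1)[OF u(1)] mem(2)[OF u(1)] mem(1)[OF g]
      mem(2)[OF g] mem(1)[OF h] mem(2)[OF h])
    show "AE x in M. A u x - z * u x = A g x - z * g x - (A h x - z * h x)"
      using u(2,3)
    proof eventually_elim
      case (elim x)
      show ?case unfolding elim by (simp add: algebra_simps)
    qed
  qed
  ultimately show ?thesis using self_adjoint_lower_bound[OF sa u(1), of z] by simp
qed

text \<open>The lower bound makes the range of A - z closed. What is orthogonal to the range is an
  eigenvector of A for the conjugate of z, and the lower bound at that point excludes it, so the
  range is everything.\<close>

lemma self_adjoint_nonreal_resolvent:
  assumes sa: "self_adjoint_operator M D A" and z: "Im z \<noteq> 0"
  shows "z \<in> resolvent_set M D A"
proof -
  note mem = self_adjoint_operatorD[OF sa]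
  define R where "R = {y \<in> L2 M. \<exists>g\<in>D. AE x in M. A g x - z * g x = y x}"
  have range_in: "(\<lambda>x. A g x - z * g x) \<in> R" if "g \<in> D" for g
    using that L2_diff[OF mem(2)[OF that] L2_scale[OF mem(1)[OF that]]] unfolding R_def by auto
  have surj: "\<exists>g\<in>D. AE x in M. A g x - z * g x = f x" if f: "f \<in> L2 M" for f
  proof -
    obtain y where y: "y \<in> R" and orth: "\<And>w. w \<in> R \<Longrightarrow> L2_inner M (\<lambda>x. f x - y x) w = 0"
    proof (rule L2_projection[of R M f])
      show "R \<subseteq> L2 M" by (auto simp: R_def)
      obtain g where "g \<in> D"
        using sa L2_zero[of M] unfolding self_adjoint_operator_def by (meson zero_less_one)
      then show "R \<noteq> {}" using range_in by auto
    next
      fix y w a b assume y: "y \<in> R" and w: "w \<in> R"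
      then obtain g h where g: "g \<in> D" "AE x in M. A g x - z * g x = y x"
        and h: "h \<in> D" "AE x in M. A h x - z * h x = w x" by (auto simp: R_def)
      obtain u where u: "u \<in> D" "AE x in M. u x = a * g x + b * h x"
        "AE x in M. A u x = a * A g x + b * A h x"
        by (rule self_adjoint_lincomb[OF sa g(1) h(1)])
      have "AE x in M. A u x - z * u x = a * y x + b * w x"
        using u(2,3) g(2) h(2)
      proof eventually_elim
        case (elim x)
        show ?case unfolding elim(1,2) elim(3,4)[symmetric] by (simp add: algebra_simps)
      qed
      then show "(\<lambda>x. a * y x + b * w x) \<in> R"
        using u(1) y w by (auto simp: R_def intro: L2_lincomb)
    next
      fix s y assume s: "\<And>n. s n \<in> R" and y: "y \<in> L2 M"
        and lim: "(\<lambda>n. L2_norm M (\<lambda>x. s n x - y x)) \<longlonglongrightarrow> 0"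
      have sL: "s n \<in> L2 M" for n using s[of n] by (simp add: R_def)
      from s obtain g where g: "\<And>n. g n \<in> D" and gs: "\<And>n. AE x in M. A (g n) x - z * g n x = s n x"
        unfolding R_def by (simp only: mem_Collect_eq) metis
      have bound: "\<bar>Im z\<bar> * L2_norm M (\<lambda>x. g m x - g n x)
          \<le> L2_norm M (\<lambda>x. s m x - y x) + L2_norm M (\<lambda>x. s n x - y x)" for m n
      proof -
        have "\<bar>Im z\<bar> * L2_norm M (\<lambda>x. g m x - g n x) \<le>
            L2_norm M (\<lambda>x. (A (g m) x - z * g m x) - (A (g n) x - z * g n x))"
          by (rule self_adjoint_lower_bound_diff[OF sa g g])
        also have "\<dots> = L2_norm M (\<lambda>x. s m x - s n x)"
        proof (intro L2_norm_cong L2_diff L2_scale mem(1)[OF g] mem(2)[OF g] sL)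
          show "AE x in M. A (g m) x - z * g m x - (A (g n) x - z * g n x) = s m x - s n x"
            using gs[of m] gs[of n] by eventually_elim simp
        qed
        also have "\<dots> \<le> L2_norm M (\<lambda>x. s m x - y x) + L2_norm M (\<lambda>x. y x - s n x)"
          using L2_norm_triangle[OF L2_diff[OF sL[of m] y] L2_diff[OF y sL[of n]]] by simp
        finally show ?thesis using L2_norm_minus_commute[of M y "s n"] by simp
      qed
      \<comment> \<open>By the lower bound the preimages inherit the Cauchy property from the
        convergent sequence of images.\<close>
      obtain g0 where g0: "g0 \<in> L2 M" and glim: "(\<lambda>n. L2_norm M (\<lambda>x. g n x - g0 x)) \<longlonglongrightarrow> 0"
      proof (rule L2_complete[of g M])
        fix \<epsilon> :: real assume "0 < \<epsilon>"
        then have "0 < \<bar>Im z\<bar> * \<epsilon> / 2" using z by simp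
        from order_tendstoD(2)[OF lim this] obtain N
          where N: "\<And>n. n \<ge> N \<Longrightarrow> L2_norm M (\<lambda>x. s n x - y x) < \<bar>Im z\<bar> * \<epsilon> / 2"
          by (auto simp: eventually_sequentially)
        have "L2_norm M (\<lambda>x. g m x - g n x) < \<epsilon>" if "m \<ge> N" "n \<ge> N" for m n
        proof -
          have "\<bar>Im z\<bar> * L2_norm M (\<lambda>x. g m x - g n x) < \<bar>Im z\<bar> * \<epsilon>"
            using bound[of m n] N[OF that(1)] N[OF that(2)] by linarith
          then show ?thesis using z by simp
        qed
        then show "\<exists>N. \<forall>m\<ge>N. \<forall>n\<ge>N. L2_norm M (\<lambda>x. g m x - g n x) < \<epsilon>" by blast
      qed (use g mem in auto)
      \<comment> \<open>The graph is closed because it is an adjoint graph: the relation <A f, g n>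
        = <f, A (g n)> survives the limit, and A (g n) tends to y + z g0.\<close>
      obtain g' where g': "g' \<in> D" "AE x in M. g' x = g0 x" "AE x in M. A g' x = 1 * y x + z * g0 x"
      proof (rule self_adjoint_adjoint_domain[OF sa g0])
        show "(\<lambda>x. 1 * y x + z * g0 x) \<in> L2 M" by (intro L2_lincomb y g0)
        fix f assume f: "f \<in> D"
        have eq: "L2_inner M (A f) (g n) = L2_inner M f (s n) + cnj z * L2_inner M f (g n)" for n
        proof -
          have "L2_inner M (A f) (g n) = L2_inner M f (A (g n))"
            by (rule self_adjoint_symmetric[OF sa f g])
          also have "\<dots> = L2_inner M f (\<lambda>x. 1 * s n x + z * g n x)"
          proof (intro L2_inner_cong L2_lincomb mem(1)[OF f] mem(1)[OF g] mem(2)[OF g] sL)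
            show "AE x in M. A (g n) x = 1 * s n x + z * g n x"
              using gs[of n] by eventually_elim (simp add: algebra_simps)
          qed auto
          also have "\<dots> = L2_inner M f (s n) + cnj z * L2_inner M f (g n)"
            using L2_inner_lincomb_right[OF sL mem(1)[OF g] mem(1)[OF f], of 1 n z n] by simp
          finally show ?thesis .
        qed
        have "(\<lambda>n. L2_inner M (A f) (g n)) \<longlonglongrightarrow> L2_inner M (A f) g0"
          by (intro L2_inner_tendsto_right mem g f g0 glim)
        moreover have "(\<lambda>n. L2_inner M f (s n) + cnj z * L2_inner M f (g n))
            \<longlonglongrightarrow> L2_inner M f y + cnj z * L2_inner M f g0"
          by (intro tendsto_intros L2_inner_tendsto_right mem g f g0 glim sL y lim)
        ultimately have "L2_inner M (A f) g0 = L2_inner M f y + cnj z * L2_inner M f g0"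
          unfolding eq by (rule LIMSEQ_unique)
        also have "\<dots> = L2_inner M f (\<lambda>x. 1 * y x + z * g0 x)"
          using L2_inner_lincomb_right[OF y g0 mem(1)[OF f], of 1 z] by simp
        finally show "L2_inner M (A f) g0 = L2_inner M f (\<lambda>x. 1 * y x + z * g0 x)" .
      qed
      have "AE x in M. A g' x - z * g' x = y x"
        using g'(2,3) by eventually_elim simp
      then show "y \<in> R" using g'(1) y by (auto simp: R_def)
    qed (use f in auto)
    have yL: "y \<in> L2 M" using y by (simp add: R_def)
    let ?w = "\<lambda>x. f x - y x"
    have w: "?w \<in> L2 M" by (rule L2_diff[OF f yL])
    \<comment> \<open>Orthogonality of f - y to the range is exactly the adjoint relation with A w =
      (cnj z) w.\<close>
    obtain w' where w': "w' \<in> D" "AE x in M. w' x = ?w x" "AE x in M. A w' x = cnj z * ?w x"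
    proof (rule self_adjoint_adjoint_domain[OF sa w])
      show "(\<lambda>x. cnj z * ?w x) \<in> L2 M" by (rule L2_scale[OF w])
      fix g assume g: "g \<in> D"
      have "cnj (L2_inner M ?w (\<lambda>x. 1 * A g x + (- z) * g x)) = 0"
        using orth[OF range_in[OF g]] by simp
      then have "L2_inner M (A g) ?w - z * L2_inner M g ?w = 0"
        unfolding L2_inner_cnj
        using L2_inner_lincomb_left[OF mem(2)[OF g] mem(1)[OF g] w, of 1 "- z"] by simp
      then show "L2_inner M (A g) ?w = L2_inner M g (\<lambda>x. cnj z * ?w x)"
        using L2_inner_lincomb_right[OF w w mem(1)[OF g], of "cnj z" 0] by simp
    qed
    have "\<bar>Im (cnj z)\<bar> * L2_norm M w' \<le> L2_norm M (\<lambda>x. A w' x - cnj z * w' x)"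
      by (rule self_adjoint_lower_bound[OF sa w'(1)])
    also have "\<dots> = L2_norm M (\<lambda>x. 0)"
    proof (intro L2_norm_cong L2_diff L2_scale mem(1)[OF w'(1)] mem(2)[OF w'(1)] L2_zero)
      show "AE x in M. A w' x - cnj z * w' x = 0"
        using w'(2,3) by eventually_elim simp
    qed
    finally have "\<bar>Im z\<bar> * L2_norm M w' \<le> 0" by (simp add: L2_norm_def)
    then have "L2_norm M w' = 0"
      using z L2_norm_nonneg[of M w'] by (auto simp: mult_le_0_iff)
    from L2_norm_eq_0[OF mem(1)[OF w'(1)] this] w'(2) have fy: "AE x in M. f x = y x"
      by eventually_elim simp
    obtain g where g: "g \<in> D" "AE x in M. A g x - z * g x = y x" using y by (auto simp: R_def)
    from g(2) fy have "AE x in M. A g x - z * g x = f x" by eventually_elim simp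
    with g(1) show ?thesis by blast
  qed
  have "L2_norm M g \<le> inverse \<bar>Im z\<bar> * L2_norm M (\<lambda>x. A g x - z * g x)" if "g \<in> D" for g
    using self_adjoint_lower_bound[OF sa that, of z] z by (simp add: field_simps)
  with surj show ?thesis unfolding resolvent_set_def by blast
qed

lemma self_adjoint_resolvent:
  assumes sa: "self_adjoint_operator M D A" and z: "Im z \<noteq> 0" and f: "f \<in> L2 M"
  shows "resolvent M D A z f \<in> D"
    and "AE x in M. A (resolvent M D A z f) x - z * resolvent M D A z f x = f x"
proof -
  have "\<exists>g. g \<in> D \<and> (AE x in M. A g x - z * g x = f x)"
    using self_adjoint_nonreal_resolvent[OF sa z] f unfolding resolvent_set_def by blast
  from someI_ex[OF this]
  show "resolvent M D A z f \<in> D" "AE x in M. A (resolvent M D A z f) x - z * resolvent M D A z f x = f x"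
    unfolding resolvent_def by auto
qed

text \<open>The diagonal entries of the resolvent determine the norm of (A - z)^(-1) f.
  Multiplication by 1 / (t - z) obeys the same law, which is what later makes the two norms
  comparable.\<close>

lemma self_adjoint_Im_resolvent:
  assumes sa: "self_adjoint_operator M D A" and z: "Im z \<noteq> 0" and f: "f \<in> L2 M"
  shows "Im (L2_inner M (resolvent M D A z f) f) = Im z * (L2_norm M (resolvent M D A z f))\<^sup>2"
proof -
  let ?u = "resolvent M D A z f"
  note u = self_adjoint_resolvent[OF assms] and mem = self_adjoint_operatorD[OF sa]
  have "L2_inner M (\<lambda>x. A ?u x - z * ?u x) ?u = L2_inner M f ?u"
    by (intro L2_inner_cong L2_diff L2_scale mem(1)[OF u(1)] mem(2)[OF u(1)] u f) auto
  then have "Im (L2_inner M f ?u) = - Im z * (L2_norm M ?u)\<^sup>2"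
    using self_adjoint_Im_inner[OF sa u(1), of z] by simp
  then show ?thesis
    using arg_cong[OF L2_inner_cnj[of M f ?u], of Im] by simp
qed

section \<open>Complex measures and the Stieltjes transform\<close>

lemma integrable_mult_bounded:
  fixes h k :: "'a \<Rightarrow> 'b::{real_normed_algebra, second_countable_topology, banach}"
  assumes k: "integrable M k" and h: "h \<in> borel_measurable M" and B: "\<And>t. norm (h t) \<le> B"
  shows "integrable M (\<lambda>t. h t * k t)"
proof (rule Bochner_Integration.integrable_bound)
  show "integrable M (\<lambda>t. B * norm (k t))" using k by simp
  show "(\<lambda>t. h t * k t) \<in> borel_measurable M"
    using borel_measurable_integrable[OF k] h by measurable
  have "norm (h t * k t) \<le> norm (B * norm (k t))" for t
  proof -
    have "norm (h t * k t) \<le> norm (h t) * norm (k t)" by (rule norm_mult_ineq)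
    also have "\<dots> \<le> B * norm (k t)" by (rule mult_right_mono[OF B]) simp
    finally show ?thesis by simp
  qed
  then show "AE t in M. norm (h t * k t) \<le> norm (B * norm (k t))" by simp
qed

text \<open>An equality between differences of measures, rearranged into sums: in this form the
  induction over measurable functions runs in the extended nonnegative reals, where subtraction
  would fail.\<close>

lemma nn_integral_eq_of_emeasure_add_eq:
  assumes sets: "sets a = sets M" "sets b = sets M" "sets c = sets M" "sets d = sets M"
    and eq: "\<And>A. A \<in> sets M \<Longrightarrow> emeasure a A + emeasure b A = emeasure c A + emeasure d A"
    and u: "u \<in> borel_measurable M"
  shows "integral\<^sup>N a u + integral\<^sup>N b u = integral\<^sup>N c u + integral\<^sup>N d u"
  using u
proof (induction rule: borel_measurable_induct)
  case (cong f g)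
  have "integral\<^sup>N x f = integral\<^sup>N x g" if "sets x = sets M" for x
    using cong(3) sets_eq_imp_space_eq[OF that] by (intro nn_integral_cong) simp
  then show ?case using cong(4) sets by simp
next
  case (set A)
  then show ?case using eq[OF set] sets by simp
next
  case (mult u r)
  have "u \<in> borel_measurable x" if "sets x = sets M" for x
    using mult(2) by (simp add: measurable_cong_sets[OF that refl])
  then have "integral\<^sup>N x (\<lambda>t. r * u t) = r * integral\<^sup>N x u" if "sets x = sets M" for x
    using that by (intro nn_integral_cmult) simp
  then show ?case using mult(4) sets by (simp flip: distrib_left)
next
  case (add u v)
  have "u \<in> borel_measurable x \<and> v \<in> borel_measurable x" if "sets x = sets M" for x
    using add(1,3) by (simp add: measurable_cong_sets[OF that refl])
  then have "integral\<^sup>N x (\<lambda>t. v t + u t) = integral\<^sup>N x v + integral\<^sup>N x u" if "sets x = sets M" for x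
    using that by (intro nn_integral_add) auto
  then show ?case using add sets by (simp add: ac_simps)
next
  case (seq U)
  have U: "U i \<in> borel_measurable x" if "sets x = sets M" for x i
    using seq(1) by (simp add: measurable_cong_sets[OF that refl])
  have *: "integral\<^sup>N x (Sup (range U)) = (SUP i. integral\<^sup>N x (U i))" if "sets x = sets M" for x
  proof -
    have "Sup (range U) = (\<lambda>t. SUP i. U i t)" by (simp add: fun_eq_iff image_comp)
    then show ?thesis using U[OF that] seq(3) nn_integral_monotone_convergence_SUP[of U x] by simp
  qed
  have inc: "incseq (\<lambda>i. integral\<^sup>N x (U i))" for x
    using seq(3) by (auto simp: incseq_def le_fun_def intro!: nn_integral_mono)
  show ?case
    unfolding *[OF sets(1)] *[OF sets(2)] *[OF sets(3)] *[OF sets(4)]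
    by (simp add: seq.IH flip: ennreal_SUP_add[OF inc inc])
qed

text \<open>The pair \<open>\<nu>1\<close>, \<open>\<nu>2\<close> need not be a Jordan
  decomposition. Splitting w into positive and negative part and moving the negative terms across
  gives \<open>\<nu>1\<close> + w^- d\<mu> = \<open>\<nu>2\<close> + w^+ d\<mu>, an identity of
  finite positive measures.\<close>

lemma signed_measure_integral_real:
  fixes w h :: "'a \<Rightarrow> real"
  assumes [measurable_cong]: "sets \<mu> = sets M" "sets \<nu>1 = sets M" "sets \<nu>2 = sets M"
    and fin: "finite_measure \<nu>1" "finite_measure \<nu>2"
    and w: "integrable \<mu> w"
    and eq: "\<And>A. A \<in> sets M \<Longrightarrow> measure \<nu>1 A - measure \<nu>2 A = (LINT t:A|\<mu>. w t)"
    and h[measurable]: "h \<in> borel_measurable M" and B: "\<And>t. \<bar>h t\<bar> \<le> B"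
  shows "(LINT t|\<nu>1. h t) - (LINT t|\<nu>2. h t) = (LINT t|\<mu>. w t * h t)"
proof -
  have [measurable]: "w \<in> borel_measurable M"
    using borel_measurable_integrable[OF w] by measurable
  let ?P = "\<lambda>t. max 0 (w t)" and ?N = "\<lambda>t. max 0 (- w t)"
  define p where "p = density \<mu> (\<lambda>t. ennreal (?P t))"
  define n where "n = density \<mu> (\<lambda>t. ennreal (?N t))"
  have [measurable_cong]: "sets p = sets M" "sets n = sets M"
    by (simp_all add: p_def n_def assms(1))
  have int: "integrable \<mu> ?P" "integrable \<mu> ?N" using w by (auto intro: integrable_max)
  have intA: "integrable \<mu> (\<lambda>t. indicator A t * ?P t)" "integrable \<mu> (\<lambda>t. indicator A t * ?N t)"
    if "A \<in> sets M" for A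
    using integrable_mult_indicator[OF _ int(1), of A] integrable_mult_indicator[OF _ int(2), of A] that
    by (simp_all add: assms(1))
  have em: "emeasure p A = ennreal (LINT t|\<mu>. indicator A t * ?P t)"
      "emeasure n A = ennreal (LINT t|\<mu>. indicator A t * ?N t)" if A: "A \<in> sets M" for A
    using A unfolding p_def n_def
    by (auto simp: emeasure_density assms(1) nn_integral_eq_integral[OF intA(1)[OF A], symmetric]
        nn_integral_eq_integral[OF intA(2)[OF A], symmetric] split: split_indicator
        intro!: nn_integral_cong)
  have sum_eq: "emeasure \<nu>1 A + emeasure n A = emeasure \<nu>2 A + emeasure p A" if A: "A \<in> sets M" for A
  proof -
    have "(LINT t:A|\<mu>. w t) = (LINT t|\<mu>. indicator A t * ?P t - indicator A t * ?N t)"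
      unfolding set_lebesgue_integral_def
      by (intro Bochner_Integration.integral_cong) (auto split: split_indicator)
    also have "\<dots> = (LINT t|\<mu>. indicator A t * ?P t) - (LINT t|\<mu>. indicator A t * ?N t)"
      by (rule Bochner_Integration.integral_diff[OF intA[OF A]])
    finally have "measure \<nu>1 A + (LINT t|\<mu>. indicator A t * ?N t)
        = measure \<nu>2 A + (LINT t|\<mu>. indicator A t * ?P t)"
      using eq[OF A] by simp
    then show ?thesis
      unfolding em[OF A] finite_measure.emeasure_eq_measure[OF fin(1)]
        finite_measure.emeasure_eq_measure[OF fin(2)]
      by (simp flip: ennreal_plus)
  qed
  have nn: "integral\<^sup>N \<nu>1 u + integral\<^sup>N n u = integral\<^sup>N \<nu>2 u + integral\<^sup>N p u"
    if "u \<in> borel_measurable M" for u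
    by (rule nn_integral_eq_of_emeasure_add_eq[OF _ _ _ _ sum_eq that])
      (simp_all add: assms \<open>sets p = sets M\<close> \<open>sets n = sets M\<close>)
  have fin': "finite_measure p" "finite_measure n"
    using em[of "space M"] sets_eq_imp_space_eq[OF \<open>sets p = sets M\<close>]
      sets_eq_imp_space_eq[OF \<open>sets n = sets M\<close>]
    by (auto intro!: finite_measureI)
  have nn_fin: "integral\<^sup>N x (\<lambda>t. ennreal (s * h t)) < \<infinity>"
    if "finite_measure x" "s \<in> {1, -1}" for x s
  proof -
    have "integral\<^sup>N x (\<lambda>t. ennreal (s * h t)) \<le> (\<integral>\<^sup>+t. ennreal B \<partial>x)"
    proof (intro nn_integral_mono ennreal_leI)
      fix t show "s * h t \<le> B" using B[of t] that(2) by auto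
    qed
    also have "\<dots> < \<infinity>"
      using finite_measure.emeasure_finite[OF that(1), of "space x"]
      by (simp add: ennreal_mult_less_top top.not_eq_extremum)
    finally show ?thesis .
  qed
  have hint: "integrable x h" if "finite_measure x" "sets x = sets M" for x
    using that B by (intro finite_measure.integrable_const_bound[of x h B])
      (auto simp: measurable_cong_sets[OF that(2) refl])
  \<comment> \<open>The sign s = 1 treats the positive part of h and s = -1 the negative part, since
    \<open>ennreal\<close> sends negative numbers to 0. All terms being finite, the identity can be
    returned to the reals and the parts subtracted.\<close>
  have part: "enn2real (integral\<^sup>N \<nu>1 (\<lambda>t. ennreal (s * h t))) + enn2real (integral\<^sup>N n (\<lambda>t. ennreal (s * h t)))
     = enn2real (integral\<^sup>N \<nu>2 (\<lambda>t. ennreal (s * h t))) + enn2real (integral\<^sup>N p (\<lambda>t. ennreal (s * h t)))"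
    if "s \<in> {1, -1}" for s
    using nn[of "\<lambda>t. ennreal (s * h t)"] nn_fin[OF fin(1) that] nn_fin[OF fin(2) that]
      nn_fin[OF fin'(1) that] nn_fin[OF fin'(2) that]
    by (simp flip: enn2real_plus)
  have "(LINT t|\<nu>1. h t) + (LINT t|n. h t) = (LINT t|\<nu>2. h t) + (LINT t|p. h t)"
    using part[of 1] part[of "-1"]
    by (simp add: real_lebesgue_integral_def hint fin fin' assms \<open>sets p = sets M\<close> \<open>sets n = sets M\<close>)
  moreover have "(LINT t|p. h t) = (LINT t|\<mu>. ?P t * h t)" "(LINT t|n. h t) = (LINT t|\<mu>. ?N t * h t)"
    unfolding p_def n_def by (subst integral_density; simp)+
  moreover have "(LINT t|\<mu>. ?P t * h t) - (LINT t|\<mu>. ?N t * h t) = (LINT t|\<mu>. ?P t * h t - ?N t * h t)"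
  proof (rule Bochner_Integration.integral_diff[symmetric])
    show "integrable \<mu> (\<lambda>t. ?P t * h t)" "integrable \<mu> (\<lambda>t. ?N t * h t)"
      using int B by (auto simp: mult.commute[of _ "h _"] intro!: integrable_mult_bounded)
  qed
  moreover have "(\<lambda>t. ?P t * h t - ?N t * h t) = (\<lambda>t. w t * h t)"
    by (rule ext) (auto simp: max_def)
  ultimately show ?thesis by simp
qed

lemma signed_measure_integral:
  fixes w :: "'a \<Rightarrow> real" and h :: "'a \<Rightarrow> complex"
  assumes sets: "sets \<mu> = sets M" "sets \<nu>1 = sets M" "sets \<nu>2 = sets M"
    and fin: "finite_measure \<nu>1" "finite_measure \<nu>2"
    and w: "integrable \<mu> w"
    and eq: "\<And>A. A \<in> sets M \<Longrightarrow> measure \<nu>1 A - measure \<nu>2 A = (LINT t:A|\<mu>. w t)"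
    and h: "h \<in> borel_measurable M" and B: "\<And>t. cmod (h t) \<le> B"
  shows "(LINT t|\<nu>1. h t) - (LINT t|\<nu>2. h t) = (LINT t|\<mu>. of_real (w t) * h t)"
proof -
  have hint: "integrable x h" if "finite_measure x" "sets x = sets M" for x
    using that B h by (intro finite_measure.integrable_const_bound[of x h B])
      (auto simp: measurable_cong_sets[OF that(2) refl])
  have "h \<in> borel_measurable \<mu>" using h by (simp add: measurable_cong_sets[OF sets(1) refl])
  then have whint: "integrable \<mu> (\<lambda>t. of_real (w t) * h t)"
    using integrable_mult_bounded[OF integrable_of_real[OF w], of h B] B by (simp add: mult.commute)
  have "Re ((LINT t|\<nu>1. h t) - (LINT t|\<nu>2. h t)) = Re (LINT t|\<mu>. of_real (w t) * h t)"
    using signed_measure_integral_real[OF sets fin w eq, of "\<lambda>t. Re (h t)" B] h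
      order.trans[OF abs_Re_le_cmod B] by (simp add: hint fin sets whint flip: integral_Re)
  moreover have "Im ((LINT t|\<nu>1. h t) - (LINT t|\<nu>2. h t)) = Im (LINT t|\<mu>. of_real (w t) * h t)"
    using signed_measure_integral_real[OF sets fin w eq, of "\<lambda>t. Im (h t)" B] h
      order.trans[OF abs_Im_le_cmod B] by (simp add: hint fin sets whint flip: integral_Im)
  ultimately show ?thesis by (simp add: complex_eq_iff)
qed

text \<open>The definition only asserts that some decomposition represents the integral; this
  removes the choice when the complex measure has a density and the integrand is bounded.\<close>

lemma has_complex_measure_integral_density:
  assumes sets: "sets \<mu> = sets borel" and k: "integrable \<mu> k"
    and int: "has_complex_measure_integral (\<lambda>A. LINT t:A|\<mu>. k t) h c"
    and h: "h \<in> borel_measurable borel" and B: "\<And>t. cmod (h t) \<le> B"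
  shows "c = (LINT t|\<mu>. h t * k t)"
proof -
  obtain \<nu>1 \<nu>2 \<nu>3 \<nu>4 where dec: "complex_measure_decomp (\<lambda>A. LINT t:A|\<mu>. k t) \<nu>1 \<nu>2 \<nu>3 \<nu>4"
    and c: "c = ((LINT t|\<nu>1. h t) - (LINT t|\<nu>2. h t)) + \<i> * ((LINT t|\<nu>3. h t) - (LINT t|\<nu>4. h t))"
    using int unfolding has_complex_measure_integral_def by blast
  have setint: "set_integrable \<mu> A k" if "A \<in> sets borel" for A
    unfolding set_integrable_def using k that sets by (intro integrable_mult_indicator) auto
  have diff: "measure \<nu>1 A - measure \<nu>2 A = (LINT t:A|\<mu>. Re (k t))"
    "measure \<nu>3 A - measure \<nu>4 A = (LINT t:A|\<mu>. Im (k t))" if A: "A \<in> sets borel" for A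
  proof -
    have "(LINT t:A|\<mu>. k t) = Complex (measure \<nu>1 A - measure \<nu>2 A) (measure \<nu>3 A - measure \<nu>4 A)"
      using dec A by (simp add: complex_measure_decomp_def)
    moreover have "Re (LINT t:A|\<mu>. k t) = (LINT t:A|\<mu>. Re (k t))"
      "Im (LINT t:A|\<mu>. k t) = (LINT t:A|\<mu>. Im (k t))"
      using setint[OF A] unfolding set_lebesgue_integral_def set_integrable_def
      by (simp_all flip: integral_Re integral_Im)
    ultimately show "measure \<nu>1 A - measure \<nu>2 A = (LINT t:A|\<mu>. Re (k t))"
      "measure \<nu>3 A - measure \<nu>4 A = (LINT t:A|\<mu>. Im (k t))" by simp_all
  qed
  have "(LINT t|\<nu>1. h t) - (LINT t|\<nu>2. h t) = (LINT t|\<mu>. of_real (Re (k t)) * h t)"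
    "(LINT t|\<nu>3. h t) - (LINT t|\<nu>4. h t) = (LINT t|\<mu>. of_real (Im (k t)) * h t)"
    using dec k h B sets diff by (auto simp: complex_measure_decomp_def intro!: signed_measure_integral[where M = borel])
  then have "c = (LINT t|\<mu>. of_real (Re (k t)) * h t) + \<i> * (LINT t|\<mu>. of_real (Im (k t)) * h t)"
    using c by simp
  also have "\<dots> = (LINT t|\<mu>. of_real (Re (k t)) * h t + \<i> * (of_real (Im (k t)) * h t))"
  proof -
    have "h \<in> borel_measurable \<mu>" using h by (simp add: measurable_cong_sets[OF sets refl])
    then have *: "integrable \<mu> (\<lambda>t. of_real (w t) * h t)" if "integrable \<mu> w" for w :: "real \<Rightarrow> real"
      using integrable_mult_bounded[OF integrable_of_real[OF that], of h B] B by (simp add: mult.commute)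
    have "integrable \<mu> (\<lambda>t. of_real (Re (k t)) * h t)" "integrable \<mu> (\<lambda>t. of_real (Im (k t)) * h t)"
      using k by (auto intro!: *)
    then show ?thesis by simp
  qed
  also have "\<dots> = (LINT t|\<mu>. h t * k t)"
    by (intro Bochner_Integration.integral_cong) (auto simp: complex_eq_iff algebra_simps)
  finally show ?thesis .
qed

section \<open>Poisson kernels and Stieltjes inversion\<close>

text \<open>The Poisson kernel is the imaginary part of the Cauchy kernel. It is written through the
  two conjugate points because it will multiply a complex density, where taking the imaginary part
  of the integral would not isolate it.\<close>

lemma Poisson_kernel_complex:
  fixes x t \<epsilon> :: real
  shows "of_real (\<epsilon> / ((t - x)\<^sup>2 + \<epsilon>\<^sup>2)) =
    (inverse (of_real t - Complex x \<epsilon>) - inverse (of_real t - Complex x (- \<epsilon>))) / (2 * \<i>)"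
proof -
  have "of_real t - Complex x e = Complex (t - x) (- e)" for e
    by (simp add: complex_eq_iff)
  moreover have "inverse (Complex (t - x) (- \<epsilon>)) - inverse (Complex (t - x) \<epsilon>)
      = 2 * \<i> * of_real (\<epsilon> / ((t - x)\<^sup>2 + \<epsilon>\<^sup>2))"
    by (simp add: complex_inverse complex_eq_iff)
  ultimately show ?thesis
    by (simp only: minus_minus) (rule nonzero_mult_div_cancel_left[symmetric], simp)
qed

lemma cmod_inverse_of_real_diff_le:
  "Im z \<noteq> 0 \<Longrightarrow> cmod (inverse (of_real t - z)) \<le> inverse \<bar>Im z\<bar>"
  using abs_Im_le_cmod[of "of_real t - z"] by (simp add: norm_inverse le_imp_inverse_le)

lemma Poisson_integral_Icc:
  fixes t \<epsilon> c d :: real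
  assumes \<epsilon>: "\<epsilon> > 0" and cd: "c \<le> d"
  shows "has_bochner_integral lborel (\<lambda>x. \<epsilon> / ((t - x)\<^sup>2 + \<epsilon>\<^sup>2) * indicator {c..d} x)
    (arctan ((d - t) / \<epsilon>) - arctan ((c - t) / \<epsilon>))"
proof (rule has_bochner_integral_FTC_Icc_nonneg[where F = "\<lambda>x. arctan ((x - t) / \<epsilon>)"])
  fix x assume "x \<in> {c..d}"
  have "(t - x)\<^sup>2 + \<epsilon>\<^sup>2 > 0" using \<epsilon> by (simp add: add_nonneg_pos)
  then show "DERIV (\<lambda>x. arctan ((x - t) / \<epsilon>)) x :> \<epsilon> / ((t - x)\<^sup>2 + \<epsilon>\<^sup>2)"
    using \<epsilon> by (auto intro!: derivative_eq_intros simp: divide_simps) (simp_all add: power2_eq_square algebra_simps)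
qed (use assms in auto)

text \<open>A shift of size 1/(n+1) with the much smaller width 1/(n+1)^2 sends the borderline a = 0
  to the upper value. The limits are therefore indicators of half-open intervals, with no half
  weights for atoms at the end points. This merges the two limits in delta and epsilon of the usual
  inversion formula into one sequence.\<close>

lemma arctan_sharpening_limit:
  fixes a :: real
  shows "(\<lambda>n. arctan ((a + inverse (real (Suc n))) / (inverse (real (Suc n)))\<^sup>2))
    \<longlonglongrightarrow> (if 0 \<le> a then pi / 2 else - (pi / 2))"
proof -
  have eq: "(a + inverse (real (Suc n))) / (inverse (real (Suc n)))\<^sup>2 = real (Suc n) * (a * real (Suc n) + 1)" for n
    by (simp add: divide_simps power2_eq_square)
  show ?thesis
  proof (cases "0 \<le> a")
    case True
    have "filterlim (\<lambda>n. real (Suc n) * (a * real (Suc n) + 1)) at_top sequentially"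
    proof (rule filterlim_at_top_mono[OF filterlim_real_sequentially], intro always_eventually allI)
      fix n
      have "real (Suc n) * 1 \<le> real (Suc n) * (a * real (Suc n) + 1)"
        using True by (intro mult_left_mono) auto
      then show "real n \<le> real (Suc n) * (a * real (Suc n) + 1)"
        by (rule order.trans[rotated]) simp
    qed
    from filterlim_compose[OF tendsto_arctan_at_top this] show ?thesis
      using True by (simp only: eq if_True)
  next
    case False
    have lin: "filterlim (\<lambda>n. a * real (Suc n) + 1) at_bot sequentially"
    proof -
      have "filterlim (\<lambda>n. (- a) * real (Suc n)) at_top sequentially"
        using False by (intro filterlim_tendsto_pos_mult_at_top[OF tendsto_const]
            filterlim_compose[OF filterlim_real_sequentially] filterlim_Suc) auto
      then have "filterlim (\<lambda>n. (-1) + (- a) * real (Suc n)) at_top sequentially"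
        by (intro filterlim_tendsto_add_at_top[OF tendsto_const])
      then show ?thesis unfolding filterlim_uminus_at_bot by (simp add: algebra_simps)
    qed
    have "filterlim (\<lambda>n. real (Suc n) * (a * real (Suc n) + 1)) at_bot sequentially"
    proof (rule filterlim_at_bot_mono[OF lin])
      have "\<forall>\<^sub>F n in sequentially. a * real (Suc n) + 1 \<le> 0"
        using lin unfolding filterlim_at_bot by blast
      then show "\<forall>\<^sub>F n in sequentially. real (Suc n) * (a * real (Suc n) + 1) \<le> a * real (Suc n) + 1"
      proof eventually_elim
        case (elim n)
        then show ?case using mult_right_mono_neg[of 1 "real (Suc n)" "a * real (Suc n) + 1"] by simp
      qed
    qed
    from filterlim_compose[OF tendsto_arctan_at_bot this] show ?thesis
      using False by (simp only: eq if_False)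
  qed
qed

text \<open>Half-open intervals form an intersection-stable generator of the Borel sets, so the
  integrals of k vanish over every Borel set, which forces k = 0 almost everywhere.\<close>

lemma AE_zero_if_Ioc_integrals_zero:
  fixes k :: "real \<Rightarrow> complex"
  assumes sets: "sets \<mu> = sets borel" and sf: "sigma_finite_measure \<mu>" and k: "integrable \<mu> k"
    and zero: "\<And>c d. c \<le> d \<Longrightarrow> (LINT t:{c<..d}|\<mu>. k t) = 0"
  shows "AE t in \<mu>. k t = 0"
proof -
  have [measurable_cong]: "sets \<mu> = sets borel" by fact
  have setint: "set_integrable \<mu> A k" if "A \<in> sets borel" for A
    unfolding set_integrable_def using k that sets by (intro integrable_mult_indicator) auto
  \<comment> \<open>The whole line is not a half-open interval, but its integral is needed for
    complements; integrability of k allows it to be exhausted.\<close>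
  have UNIV0: "(LINT t|\<mu>. k t) = 0"
  proof (rule LIMSEQ_unique)
    show "(\<lambda>n::nat. LINT t:{- real n<..real n}|\<mu>. k t) \<longlonglongrightarrow> (LINT t|\<mu>. k t)"
      unfolding set_lebesgue_integral_def
    proof (rule integral_dominated_convergence)
      show "integrable \<mu> (\<lambda>t. norm (k t))" using k by simp
      show "AE t in \<mu>. (\<lambda>n. indicat_real {- real n<..real n} t *\<^sub>R k t) \<longlonglongrightarrow> k t"
      proof (rule AE_I2)
        fix t :: real
        have "\<forall>\<^sub>F n in sequentially. \<bar>t\<bar> + 1 \<le> real n"
          using filterlim_real_sequentially unfolding filterlim_at_top by blast
        then have "\<forall>\<^sub>F n in sequentially. indicat_real {- real n<..real n} t *\<^sub>R k t = k t"
          by eventually_elim (auto split: split_indicator)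
        then show "(\<lambda>n. indicat_real {- real n<..real n} t *\<^sub>R k t) \<longlonglongrightarrow> k t"
          by (rule tendsto_eventually)
      qed
      show "k \<in> borel_measurable \<mu>" using k by auto
      then show "(\<lambda>t. indicat_real {- real n<..real n} t *\<^sub>R k t) \<in> borel_measurable \<mu>" for n
        by measurable
      show "AE t in \<mu>. norm (indicat_real {- real n<..real n} t *\<^sub>R k t) \<le> norm (k t)" for n
        by (auto split: split_indicator)
    qed
    show "(\<lambda>n::nat. LINT t:{- real n<..real n}|\<mu>. k t) \<longlonglongrightarrow> 0"
      by (simp add: zero)
  qed
  let ?G = "range (\<lambda>(a, b). {a <.. b::real})"
  have "(LINT t:A|\<mu>. k t) = 0" if "A \<in> sets borel" for A
  proof -
    have "{a<..b} \<inter> {c<..d} \<in> ?G" for a b c d :: real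
      by (rule image_eqI[of _ _ "(max a c, min b d)"]) auto
    then have stable: "Int_stable ?G" by (auto simp: Int_stable_def)
    have sig: "sigma_sets UNIV ?G = sets borel"
      using arg_cong[OF borel_sigma_sets_Ioc, of sets] by simp
    have "A \<in> sigma_sets UNIV ?G" using that sig by simp
    then show ?thesis
    proof (induction A rule: sigma_sets_induct_disjoint[OF stable, where \<Omega> = UNIV, simplified, consumes 1, case_names basic empty compl union])
      case (basic A)
      then obtain a b where "A = {a<..b}" by auto
      then show ?case using zero[of a b] by (cases "a \<le> b") (auto simp: set_lebesgue_integral_def)
    next
      case empty
      show ?case by (simp add: set_lebesgue_integral_def)
    next
      case (compl A)
      then have A: "A \<in> sets borel" using sig by simp
      have "(LINT t:UNIV - A|\<mu>. k t) = (LINT t|\<mu>. k t - indicat_real A t *\<^sub>R k t)"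
        unfolding set_lebesgue_integral_def
        by (intro Bochner_Integration.integral_cong) (auto split: split_indicator)
      also have "\<dots> = (LINT t|\<mu>. k t) - (LINT t:A|\<mu>. k t)"
        unfolding set_lebesgue_integral_def using k setint[OF A]
        by (intro Bochner_Integration.integral_diff) (auto simp: set_integrable_def)
      finally show ?case using UNIV0 compl by simp
    next
      case (union A)
      have "(LINT t:(\<Union>i. A i)|\<mu>. k t) = (\<Sum>i. (LINT t:(A i)|\<mu>. k t))"
      proof (rule lebesgue_integral_countable_add)
        show "A i \<in> sets \<mu>" for i using union sig sets by auto
        then show "set_integrable \<mu> (\<Union>i. A i) k" using sets by (intro setint) auto
        show "i \<noteq> j \<Longrightarrow> A i \<inter> A j = {}" for i j
          using union(1) by (auto simp: disjoint_family_on_def)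
      qed
      then show ?case using union by simp
    qed
  qed
  then show ?thesis
    by (intro sigma_finite_measure.density_unique_banach[OF sf k]) (auto simp: sets set_lebesgue_integral_def)
qed

text \<open>Stieltjes inversion: vanishing Cauchy integrals give vanishing Poisson integrals, and
  integrating these over x produces smoothed indicators that sharpen to those of half-open
  intervals.\<close>

lemma Stieltjes_transform_zero:
  fixes k :: "real \<Rightarrow> complex"
  assumes sets: "sets \<mu> = sets borel" and sf: "sigma_finite_measure \<mu>" and k: "integrable \<mu> k"
    and zero: "\<And>z. Im z \<noteq> 0 \<Longrightarrow> (LINT t|\<mu>. inverse (of_real t - z) * k t) = 0"
  shows "AE t in \<mu>. k t = 0"
proof (rule AE_zero_if_Ioc_integrals_zero[OF sets sf k])
  have [measurable_cong]: "sets \<mu> = sets borel" by fact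
  have [measurable]: "k \<in> borel_measurable \<mu>" using k by auto
  interpret pair_sigma_finite \<mu> lborel
    using sf sigma_finite_lborel by (simp add: pair_sigma_finite_def)
  have Poisson: "(LINT t|\<mu>. of_real (\<epsilon> / ((t - x)\<^sup>2 + \<epsilon>\<^sup>2)) * k t) = 0" if "\<epsilon> > 0" for x \<epsilon>
  proof -
    have int: "integrable \<mu> (\<lambda>t. inverse (of_real t - z) * k t)" if "Im z \<noteq> 0" for z
      using cmod_inverse_of_real_diff_le[OF that] by (intro integrable_mult_bounded[OF k]) auto
    have "(LINT t|\<mu>. of_real (\<epsilon> / ((t - x)\<^sup>2 + \<epsilon>\<^sup>2)) * k t) =
      (LINT t|\<mu>. (inverse (of_real t - Complex x \<epsilon>) * k t
        - inverse (of_real t - Complex x (- \<epsilon>)) * k t) / (2 * \<i>))"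
      unfolding Poisson_kernel_complex by (simp add: algebra_simps diff_divide_distrib)
    also have "\<dots> = 0"
      using that int[of "Complex x \<epsilon>"] int[of "Complex x (- \<epsilon>)"] zero[of "Complex x \<epsilon>"]
        zero[of "Complex x (- \<epsilon>)"] by simp
    finally show ?thesis .
  qed
  \<comment> \<open>Fubini in (t, x): integrating the kernel over x in [c, d] first gives the
    difference of arctangents, bounded by pi, so integrability of k alone justifies the
    exchange.\<close>
  have arctan: "(LINT t|\<mu>. of_real (arctan ((d - t) / \<epsilon>) - arctan ((c - t) / \<epsilon>)) * k t) = 0"
    if \<epsilon>: "\<epsilon> > 0" and cd: "c \<le> d" for c d \<epsilon>
  proof -
    define f where "f t x = of_real (\<epsilon> / ((t - x)\<^sup>2 + \<epsilon>\<^sup>2) * indicator {c..d} x) * k t" for t x :: real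
    define a where "a t = arctan ((d - t) / \<epsilon>) - arctan ((c - t) / \<epsilon>)" for t
    have P: "has_bochner_integral lborel (\<lambda>x. \<epsilon> / ((t - x)\<^sup>2 + \<epsilon>\<^sup>2) * indicator {c..d} x) (a t)" for t
      unfolding a_def by (rule Poisson_integral_Icc[OF \<epsilon> cd])
    have a_bound: "norm (a t) \<le> pi" for t
      using arctan_bounded[of "(d - t) / \<epsilon>"] arctan_bounded[of "(c - t) / \<epsilon>"]
      unfolding a_def by (simp add: abs_le_iff)
    have [measurable]: "a \<in> borel_measurable borel" unfolding a_def by measurable
    have fx: "integrable lborel (f t)" "(LINT x|lborel. f t x) = of_real (a t) * k t" for t
      using P[of t] unfolding f_def
      by (auto simp: has_bochner_integral_iff simp del: of_real_mult of_real_divide)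
    have "integrable (\<mu> \<Otimes>\<^sub>M lborel) (case_prod f)"
    proof (rule Fubini_integrable)
      show "case_prod f \<in> borel_measurable (\<mu> \<Otimes>\<^sub>M lborel)" unfolding f_def by measurable
      have "norm (f t x) = \<epsilon> / ((t - x)\<^sup>2 + \<epsilon>\<^sup>2) * indicator {c..d} x * norm (k t)" for t x
        using \<epsilon> by (simp add: f_def norm_mult norm_divide del: of_real_add of_real_power
            flip: of_real_add of_real_power split: split_indicator)
      then have "(LINT x|lborel. norm (f t x)) = a t * norm (k t)" for t
        using P[of t] by (simp only: has_bochner_integral_iff integral_mult_left_zero)
      then show "integrable \<mu> (\<lambda>t. LINT x|lborel. norm (case_prod f (t, x)))"
        using integrable_mult_bounded[of \<mu> "\<lambda>t. norm (k t)" a pi] k a_bound by simp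
      show "AE t in \<mu>. integrable lborel (\<lambda>x. case_prod f (t, x))" using fx by simp
    qed
    from Fubini_integral[OF this]
    have "(LINT t|\<mu>. of_real (a t) * k t) = (LINT x|lborel. LINT t|\<mu>. f t x)"
      by (simp add: fx)
    also have "(\<lambda>x. LINT t|\<mu>. f t x) = (\<lambda>x. 0)"
    proof
      fix x
      have "f t x = of_real (indicator {c..d} x) * (of_real (\<epsilon> / ((t - x)\<^sup>2 + \<epsilon>\<^sup>2)) * k t)" for t
        by (simp add: f_def)
      then show "(LINT t|\<mu>. f t x) = 0" by (simp only: integral_mult_right_zero Poisson[OF \<epsilon>] mult_zero_right)
    qed
    finally show ?thesis by (simp add: a_def)
  qed
  fix c d :: real assume cd: "c \<le> d"
  \<comment> \<open>Shift \<open>b n\<close> and width \<open>(b n)^2\<close> are coupled so that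
    the shift wins, as in the limit of the arctangents.\<close>
  define b where "b n = inverse (real (Suc n))" for n
  define g where "g n t = arctan ((d + b n - t) / (b n)\<^sup>2) - arctan ((c + b n - t) / (b n)\<^sup>2)" for n t
  have b_pos: "b n > 0" for n by (simp add: b_def)
  have g_lim: "(\<lambda>n. g n t) \<longlonglongrightarrow> pi * indicat_real {c<..d} t" for t
  proof -
    have "(if 0 \<le> d - t then pi / 2 else - (pi / 2)) - (if 0 \<le> c - t then pi / 2 else - (pi / 2))
        = pi * indicat_real {c<..d} t"
      using cd by (auto split: split_indicator)
    with tendsto_diff[OF arctan_sharpening_limit[of "d - t"] arctan_sharpening_limit[of "c - t"]]
    show ?thesis by (simp only: g_def b_def diff_add_eq)
  qed
  have "(\<lambda>n. LINT t|\<mu>. of_real (g n t) * k t) \<longlonglongrightarrow> (LINT t|\<mu>. of_real (pi * indicat_real {c<..d} t) * k t)"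
  proof (rule integral_dominated_convergence)
    show "integrable \<mu> (\<lambda>t. pi * norm (k t))" using k by simp
    show "AE t in \<mu>. (\<lambda>n. of_real (g n t) * k t) \<longlonglongrightarrow> of_real (pi * indicat_real {c<..d} t) * k t"
      by (intro AE_I2 tendsto_intros g_lim)
    show "AE t in \<mu>. norm (of_real (g n t) * k t) \<le> pi * norm (k t)" for n
    proof (intro AE_I2)
      fix t
      have "\<bar>g n t\<bar> \<le> pi"
        using arctan_bounded[of "(d + b n - t) / (b n)\<^sup>2"] arctan_bounded[of "(c + b n - t) / (b n)\<^sup>2"]
        unfolding g_def by (simp add: abs_le_iff)
      then show "norm (of_real (g n t) * k t) \<le> pi * norm (k t)"
        by (simp add: norm_mult mult_right_mono)
    qed
    show "(\<lambda>t. of_real (g n t) * k t) \<in> borel_measurable \<mu>" for n unfolding g_def by measurable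
  qed measurable
  moreover have "(LINT t|\<mu>. of_real (g n t) * k t) = 0" for n
    using arctan[of "(b n)\<^sup>2" "c + b n" "d + b n"] b_pos[of n] cd unfolding g_def by simp
  ultimately have "(LINT t|\<mu>. of_real (pi * indicat_real {c<..d} t) * k t) = 0"
    by (simp add: LIMSEQ_const_iff)
  moreover have "(LINT t|\<mu>. of_real (pi * indicat_real {c<..d} t) * k t)
      = of_real pi * (LINT t:{c<..d}|\<mu>. k t)"
    unfolding set_lebesgue_integral_def
    by (subst integral_mult_right_zero[symmetric]) (simp add: scaleR_conv_of_real mult.assoc)
  ultimately show "(LINT t:{c<..d}|\<mu>. k t) = 0" by simp
qed

section \<open>The weighted space of a Sturm--Liouville expression\<close>

lemma abs_cont_on_imp_continuous_on:
  assumes "abs_cont_on c d f"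
  shows "continuous_on {c..d} f"
  unfolding continuous_on_iff
proof (intro ballI allI impI)
  fix x e :: real assume x: "x \<in> {c..d}" and "0 < e"
  then obtain \<delta> where "\<delta> > 0" and \<delta>: "\<And>P. finite P \<Longrightarrow>
        (\<forall>(u, w)\<in>P. c \<le> u \<and> u \<le> w \<and> w \<le> d) \<Longrightarrow>
        disjoint_family_on (\<lambda>(u, w). {u<..<w}) P \<Longrightarrow>
        (\<Sum>(u, w)\<in>P. w - u) < \<delta> \<Longrightarrow> (\<Sum>(u, w)\<in>P. cmod (f w - f u)) < e"
    using assms unfolding abs_cont_on_def by blast
  have "dist (f y) (f x) < e" if y: "y \<in> {c..d}" "dist y x < \<delta>" for y
    using \<delta>[of "{(min x y, max x y)}"] x y
    by (cases "x \<le> y") (auto simp: disjoint_family_on_def dist_norm min_def max_def norm_minus_commute)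
  with \<open>\<delta> > 0\<close> show "\<exists>\<delta>>0. \<forall>y\<in>{c..d}. dist y x < \<delta> \<longrightarrow> dist (f y) (f x) < e" by blast
qed

lemma open_sl_interval: "open (sl_interval T)"
  by (simp add: sl_interval_def)

lemma AC_loc_imp_continuous_on:
  assumes "f \<in> AC_loc T"
  shows "continuous_on (sl_interval T) f"
proof (rule continuous_at_imp_continuous_on, rule ballI)
  fix x assume "x \<in> sl_interval T"
  then obtain e where "e > 0" and e: "cball x e \<subseteq> sl_interval T"
    using open_sl_interval open_contains_cball by blast
  then have "continuous_on {x - e..x + e} f"
    using assms by (auto simp: AC_loc_def cball_eq_atLeastAtMost intro!: abs_cont_on_imp_continuous_on)
  then show "isCont f x"
    by (rule continuous_on_interior) (use \<open>e > 0\<close> in auto)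
qed

lemma sl_interval_exhaustion:
  assumes "sl_expression T"
  obtains l u :: "nat \<Rightarrow> real" where "incseq u" "decseq l" "\<And>i. {l i..u i} \<subseteq> sl_interval T"
    "sl_interval T = (\<Union>i. {l i..u i})"
proof -
  have "left_end T < right_end T" using assms by (simp add: sl_expression_def)
  from einterval_Icc_approximation[OF this] obtain u l where
    "einterval (left_end T) (right_end T) = (\<Union>i. {l i..u i})" "incseq u" "decseq l" by metis
  then show ?thesis using that[of u l] by (auto simp: sl_interval_def)
qed

lemma sl_interval_lebesgue [measurable]: "sl_interval T \<in> sets lebesgue"
  by (simp add: borel_open open_sl_interval)

lemma sets_weighted: "sets (weighted T) = sets (lebesgue_on (sl_interval T))"
  by (simp add: weighted_on_def)

lemma space_weighted: "space (weighted T) = sl_interval T"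
  by (simp add: weighted_on_def)

lemma Icc_sets_weighted: "{c..d} \<subseteq> sl_interval T \<Longrightarrow> {c..d} \<in> sets (weighted T)"
  by (simp add: sets_weighted sets_restrict_space_iff)

lemma continuous_measurable_weighted:
  "continuous_on (sl_interval T) f \<Longrightarrow> f \<in> borel_measurable (weighted T)"
  for f :: "real \<Rightarrow> complex"
  using continuous_imp_measurable_on_sets_lebesgue[OF _ sl_interval_lebesgue]
  by (simp add: measurable_cong_sets[OF sets_weighted refl])

lemma emeasure_weighted_Icc:
  assumes T: "sl_expression T" and cd: "{c..d} \<subseteq> sl_interval T"
  shows "emeasure (weighted T) {c..d} = (\<integral>\<^sup>+x. ennreal (r_coeff T x) * indicator {c..d} x \<partial>lebesgue)"
proof -
  have r: "r_coeff T \<in> borel_measurable (lebesgue_on (sl_interval T))"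
    using T by (simp add: sl_expression_def)
  have "emeasure (weighted T) {c..d}
      = (\<integral>\<^sup>+x. ennreal (r_coeff T x) * indicator {c..d} x \<partial>lebesgue_on (sl_interval T))"
    unfolding weighted_on_def using r cd
    by (intro emeasure_density) (auto simp: sets_restrict_space_iff)
  also have "\<dots> = (\<integral>\<^sup>+x. ennreal (r_coeff T x) * indicator {c..d} x * indicator (sl_interval T) x \<partial>lebesgue)"
    by (rule nn_integral_restrict_space) simp
  also have "\<dots> = (\<integral>\<^sup>+x. ennreal (r_coeff T x) * indicator {c..d} x \<partial>lebesgue)"
    using cd by (intro nn_integral_cong) (auto split: split_indicator)
  finally show ?thesis .
qed

lemma emeasure_weighted_Icc_finite:
  assumes T: "sl_expression T" and cd: "{c..d} \<subseteq> sl_interval T"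
  shows "emeasure (weighted T) {c..d} < \<infinity>"
proof -
  have "r_coeff T absolutely_integrable_on {c..d}"
    using T cd by (auto simp: sl_expression_def L1_loc_def)
  then have "(\<integral>\<^sup>+x. ennreal (norm (indicat_real {c..d} x *\<^sub>R r_coeff T x)) \<partial>lebesgue) < \<infinity>"
    unfolding set_integrable_def integrable_iff_bounded by blast
  moreover have "emeasure (weighted T) {c..d}
      \<le> (\<integral>\<^sup>+x. ennreal (norm (indicat_real {c..d} x *\<^sub>R r_coeff T x)) \<partial>lebesgue)"
    unfolding emeasure_weighted_Icc[OF assms]
    by (intro nn_integral_mono) (auto split: split_indicator intro!: ennreal_leI)
  ultimately show ?thesis by simp
qed

text \<open>Since r > 0 almost everywhere, null sets for r dx are Lebesgue null. This keeps
  integrals of a positive function over a small interval from vanishing.\<close>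

lemma emeasure_weighted_Icc_pos:
  assumes T: "sl_expression T" and cd: "{c..d} \<subseteq> sl_interval T" "c < d"
  shows "emeasure (weighted T) {c..d} \<noteq> 0"
proof
  assume "emeasure (weighted T) {c..d} = 0"
  then have "{c..d} \<in> null_sets (weighted T)"
    using Icc_sets_weighted[OF cd(1)] by (simp add: null_sets_def)
  then have "AE x in weighted T. x \<notin> {c..d}" by (rule AE_not_in)
  moreover have r: "r_coeff T \<in> borel_measurable (lebesgue_on (sl_interval T))"
    using T by (simp add: sl_expression_def)
  ultimately have "AE x in lebesgue_on (sl_interval T). 0 < r_coeff T x \<longrightarrow> x \<notin> {c..d}"
    unfolding weighted_on_def by (subst (asm) AE_density) auto
  moreover have "AE x in lebesgue_on (sl_interval T). 0 < r_coeff T x"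
    using T by (auto simp: sl_expression_def elim: eventually_mono)
  ultimately have "AE x in lebesgue_on (sl_interval T). x \<notin> {c..d}"
    by eventually_elim simp
  then have "AE x in lebesgue. x \<in> sl_interval T \<longrightarrow> x \<notin> {c..d}"
    by (subst (asm) AE_restrict_space_iff) simp_all
  then have "AE x in lebesgue. x \<notin> {c..d}"
    by eventually_elim (use cd(1) in auto)
  then have "{c..d} \<in> null_sets lebesgue" by (subst AE_iff_null_sets) auto
  then have "emeasure lebesgue {c..d} = 0" by auto
  then show False using cd(2) by simp
qed

lemma sigma_finite_weighted:
  assumes "sl_expression T"
  shows "sigma_finite_measure (weighted T)"
proof -
  obtain l u :: "nat \<Rightarrow> real" where "incseq u" "decseq l" and lu: "\<And>i. {l i..u i} \<subseteq> sl_interval T"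
    "sl_interval T = (\<Union>i. {l i..u i})"
    by (rule sl_interval_exhaustion[OF assms]) blast
  show ?thesis
  proof (standard, intro exI conjI ballI)
    show "countable (range (\<lambda>i. {l i..u i}))" by simp
    show "range (\<lambda>i. {l i..u i}) \<subseteq> sets (weighted T)" using Icc_sets_weighted lu(1) by auto
    show "\<Union> (range (\<lambda>i. {l i..u i})) = space (weighted T)" using lu(2) space_weighted[of T] by simp
    show "emeasure (weighted T) a \<noteq> \<infinity>" if "a \<in> range (\<lambda>i. {l i..u i})" for a
    proof -
      from that obtain i where "a = {l i..u i}" by blast
      then show ?thesis using emeasure_weighted_Icc_finite[OF assms lu(1)[of i]] by simp
    qed
  qed
qed

lemma bounded_on_Icc_in_L2:
  assumes T: "sl_expression T" and cd: "{c..d} \<subseteq> sl_interval T"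
    and f: "f \<in> borel_measurable (weighted T)" and B: "\<And>x. x \<in> {c..d} \<Longrightarrow> cmod (f x) \<le> B"
  shows "(\<lambda>x. if x \<in> {c..d} then f x else 0) \<in> L2 (weighted T)"
proof (rule L2_dominated)
  have [measurable]: "{c..d} \<in> sets (weighted T)" by (rule Icc_sets_weighted[OF cd])
  have "integrable (weighted T) (\<lambda>x. indicat_real {c..d} x)"
    using emeasure_weighted_Icc_finite[OF T cd] by (simp add: less_top)
  moreover have "(cmod (indicator {c..d} x))\<^sup>2 = indicat_real {c..d} x" for x :: real
    by (simp split: split_indicator)
  ultimately show "indicator {c..d} \<in> L2 (weighted T)" by (simp add: L2_def)
  show "(\<lambda>x. if x \<in> {c..d} then f x else 0) \<in> borel_measurable (weighted T)" using f by measurable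
  show "AE x in weighted T. cmod (if x \<in> {c..d} then f x else 0) \<le> B * cmod (indicator {c..d} x)"
    using B by auto
qed

lemma L2_c_truncation:
  assumes f: "f \<in> L2 (weighted T)" and cd: "{c..d} \<subseteq> sl_interval T"
  shows "(\<lambda>x. if x \<in> {c..d} then f x else 0) \<in> L2_c T"
proof -
  have "{c..d} \<in> sets (weighted T)" by (rule Icc_sets_weighted[OF cd])
  then have "(\<lambda>x. if x \<in> {c..d} then f x else 0) \<in> borel_measurable (weighted T)"
    using L2_measurable[OF f] by measurable
  then have "(\<lambda>x. if x \<in> {c..d} then f x else 0) \<in> L2 (weighted T)"
    by (rule L2_dominated[OF f, where C = 1]) simp
  moreover have "AE x in weighted T. x \<notin> {c..d} \<longrightarrow> (if x \<in> {c..d} then f x else 0) = 0"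
    by simp
  ultimately show ?thesis using cd unfolding L2_c_def by blast
qed

lemma L2_c_dense:
  assumes T: "sl_expression T" and f: "f \<in> L2 (weighted T)"
  obtains s where "\<And>n. s n \<in> L2_c T" "(\<lambda>n. L2_norm (weighted T) (\<lambda>x. s n x - f x)) \<longlonglongrightarrow> 0"
proof -
  obtain l u :: "nat \<Rightarrow> real" where lu: "incseq u" "decseq l" "\<And>i. {l i..u i} \<subseteq> sl_interval T"
    "sl_interval T = (\<Union>i. {l i..u i})"
    by (rule sl_interval_exhaustion[OF T]) blast
  have "(\<lambda>n. L2_norm (weighted T) (\<lambda>x. (if x \<in> {l n..u n} then f x else 0) - f x)) \<longlonglongrightarrow> 0"
  proof (rule L2_truncation_tendsto[OF f])
    show "{x \<in> space (weighted T). x \<in> {l n..u n}} \<in> sets (weighted T)" for n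
    proof -
      have "{x \<in> space (weighted T). x \<in> {l n..u n}} = {l n..u n}"
        using lu(3)[of n] by (auto simp: space_weighted)
      then show ?thesis by (simp only: Icc_sets_weighted[OF lu(3)])
    qed
    fix x assume "x \<in> space (weighted T)"
    then have "x \<in> sl_interval T" by (simp only: space_weighted)
    then obtain i where i: "x \<in> {l i..u i}" using lu(4) by blast
    have "x \<in> {l n..u n}" if "n \<ge> i" for n
      using i incseqD[OF lu(1) that] decseqD[OF lu(2) that] by auto
    then show "\<forall>\<^sub>F n in sequentially. x \<in> {l n..u n}" by (auto simp: eventually_sequentially)
  qed
  then show ?thesis by (rule that[OF L2_c_truncation[OF f lu(3)]])
qed

text \<open>Discretise the variable in which the function is continuous.\<close>

lemma Caratheodory_jointly_measurable:
  fixes \<Phi> :: "real \<Rightarrow> 'a \<Rightarrow> complex"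
  assumes meas: "\<And>t. \<Phi> t \<in> borel_measurable M"
    and cont: "\<And>x. x \<in> space M \<Longrightarrow> continuous_on UNIV (\<lambda>t. \<Phi> t x)"
  shows "(\<lambda>(t, x). \<Phi> t x) \<in> borel_measurable (borel \<Otimes>\<^sub>M M)"
proof (rule borel_measurable_LIMSEQ_metric)
  define a :: "nat \<Rightarrow> real \<Rightarrow> real" where "a n t = of_int \<lfloor>t * real (Suc n)\<rfloor> / real (Suc n)" for n t
  show "(\<lambda>(t, x). \<Phi> (a n t) x) \<in> borel_measurable (borel \<Otimes>\<^sub>M M)" for n
  proof -
    have "(\<lambda>p. \<Phi> (of_int \<lfloor>fst p * real (Suc n)\<rfloor> / real (Suc n)) (snd p)) \<in> borel_measurable (borel \<Otimes>\<^sub>M M)"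
    proof (rule measurable_compose_countable[where f = "\<lambda>i p. \<Phi> (of_int i / real (Suc n)) (snd p)"])
      show "(\<lambda>p. \<Phi> (of_int i / real (Suc n)) (snd p)) \<in> borel_measurable (borel \<Otimes>\<^sub>M M)" for i
        using meas by measurable
    qed measurable
    then show ?thesis by (simp add: a_def case_prod_unfold)
  qed
  fix p :: "real \<times> 'a" assume "p \<in> space (borel \<Otimes>\<^sub>M M)"
  then obtain t :: real and x where p: "p = (t, x)" "x \<in> space M" by (auto simp: space_pair_measure)
  have "(\<lambda>n. a n t) \<longlonglongrightarrow> t"
  proof (rule LIM_zero_cancel, rule Lim_null_comparison[OF _ LIMSEQ_inverse_real_of_nat],
      intro always_eventually allI)
    fix n
    have "\<bar>real_of_int \<lfloor>t * real (Suc n)\<rfloor> - t * real (Suc n)\<bar> \<le> 1"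
      using of_int_floor_le[of "t * real (Suc n)"] real_of_int_floor_add_one_gt[of "t * real (Suc n)"]
      by linarith
    moreover have "a n t - t = (of_int \<lfloor>t * real (Suc n)\<rfloor> - t * real (Suc n)) / real (Suc n)"
      by (simp add: a_def diff_divide_distrib)
    ultimately show "norm (a n t - t) \<le> inverse (real (Suc n))"
      by (simp add: abs_divide inverse_eq_divide divide_right_mono del: of_nat_Suc)
  qed
  moreover have "isCont (\<lambda>t. \<Phi> t x) t"
    using cont[OF p(2)] by (simp add: continuous_on_eq_continuous_at)
  ultimately show "(\<lambda>n. case p of (t, x) \<Rightarrow> \<Phi> (a n t) x) \<longlonglongrightarrow> (case p of (t, x) \<Rightarrow> \<Phi> t x)"
    unfolding p(1) prod.case by (rule isCont_tendsto_compose[rotated])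
qed

section \<open>The spectral transformation\<close>

text \<open>What the differential equation supplies about \<open>\<phi>\<close> is condensed into
  continuity in x, nontriviality for every z, and real entire dependence on z; the operator enters
  through self-adjointness and the density formula.\<close>

locale spectral_pair =
  fixes T :: sl_data and v :: "endpoint \<Rightarrow> real \<Rightarrow> complex" and \<phi> :: "complex \<Rightarrow> real \<Rightarrow> complex"
    and \<mu> :: "real measure" and F G :: "(real \<Rightarrow> complex) \<Rightarrow> (real \<Rightarrow> complex)"
  assumes T: "sl_expression T"
    and sa: "self_adjoint_operator (weighted T) (dom_S T v) (tau T)"
    and sets_\<mu>: "sets \<mu> = sets borel"
    and \<mu>_finite: "\<And>l1 l2. l1 < l2 \<Longrightarrow> emeasure \<mu> {l1<..l2} \<noteq> \<infinity>"
    and \<phi>_continuous: "\<And>z. continuous_on (sl_interval T) (\<phi> z)"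
    and \<phi>_nonzero: "\<And>z. \<exists>x\<in>sl_interval T. \<phi> z x \<noteq> 0"
    and \<phi>_entire: "\<And>x. x \<in> sl_interval T \<Longrightarrow> real_entire (\<lambda>z. \<phi> z x)"
    and density: "spectral_density_formula T v \<phi> \<mu>"
    and transform: "spectral_transform T \<phi> \<mu> F"
    and inverse_transform: "inverse_spectral_transform T \<phi> \<mu> G"
begin

abbreviation M :: "real measure" where "M \<equiv> weighted T"

lemma space_\<mu>: "space \<mu> = UNIV"
  using sets_eq_imp_space_eq[OF sets_\<mu>] by simp

lemma sigma_finite_\<mu>: "sigma_finite_measure \<mu>"
proof (standard, intro exI conjI ballI)
  show "countable (range (\<lambda>n::nat. {- real (Suc n)<..real n}))" by simp
  \<comment> \<open>The successor at the left end keeps the interval nondegenerate for n = 0, as the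
    finiteness assumption asks for l1 < l2.\<close>
  show "range (\<lambda>n::nat. {- real (Suc n)<..real n}) \<subseteq> sets \<mu>" by (auto simp: sets_\<mu>)
  have "\<exists>n. t \<in> {- real (Suc n)<..real n}" for t :: real
  proof -
    obtain n where "\<bar>t\<bar> \<le> real n" using real_arch_simple by blast
    then show ?thesis by (intro exI[of _ n]) auto
  qed
  then show "\<Union> (range (\<lambda>n::nat. {- real (Suc n)<..real n})) = space \<mu>" by (auto simp: space_\<mu>)
  show "emeasure \<mu> a \<noteq> \<infinity>" if "a \<in> range (\<lambda>n::nat. {- real (Suc n)<..real n})" for a
    using that \<mu>_finite by auto
qed

lemma F_isometry: "L2_isometry M \<mu> F"
  and F_hat: "f \<in> L2_c T \<Longrightarrow> AE t in \<mu>. F f t = hat T \<phi> f (of_real t)"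
  using transform by (auto simp: spectral_transform_def)

lemma F_bounded: "L2_bounded_linear M \<mu> F"
  by (rule L2_isometry_imp_bounded_linear[OF F_isometry])

lemma G_bounded: "L2_bounded_linear \<mu> M G"
  and G_check: "g \<in> L2_compact \<mu> \<Longrightarrow> AE x in M. G g x = check \<mu> \<phi> g x"
  using inverse_transform by (auto simp: inverse_spectral_transform_def)

lemma F_L2: "f \<in> L2 M \<Longrightarrow> F f \<in> L2 \<mu>" and G_L2: "g \<in> L2 \<mu> \<Longrightarrow> G g \<in> L2 M"
  using F_bounded G_bounded by (auto simp: L2_bounded_linear_def L2_linear_def)

lemma L2_c_L2: "f \<in> L2_c T \<Longrightarrow> f \<in> L2 M"
  by (simp add: L2_c_def)

lemma cnj_\<phi>: "x \<in> sl_interval T \<Longrightarrow> cnj (\<phi> (of_real t) x) = \<phi> (of_real t) x"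
  using \<phi>_entire[of x] by (simp add: real_entire_def Reals_cnj_iff)

lemma \<phi>_measurable: "\<phi> z \<in> borel_measurable M"
  by (rule continuous_measurable_weighted[OF \<phi>_continuous])

text \<open>Fubini for the kernel needs measurability on the product; entire dependence on z gives
  continuity in t, while continuity in x gives measurability of each section.\<close>

lemma \<phi>_jointly_measurable: "(\<lambda>(t, x). \<phi> (of_real t) x) \<in> borel_measurable (\<mu> \<Otimes>\<^sub>M M)"
proof -
  have "(\<lambda>(t, x). \<phi> (of_real t) x) \<in> borel_measurable (borel \<Otimes>\<^sub>M M)"
  proof (rule Caratheodory_jointly_measurable[OF \<phi>_measurable])
    fix x assume "x \<in> space M"
    then have "continuous_on UNIV (\<lambda>z. \<phi> z x)"
      using \<phi>_entire by (auto simp: space_weighted real_entire_def intro: holomorphic_on_imp_continuous_on)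
    then show "continuous_on UNIV (\<lambda>t. \<phi> (complex_of_real t) x)"
      by (rule continuous_on_compose2) (auto intro: continuous_intros)
  qed
  then show ?thesis
    unfolding measurable_cong_sets[OF sets_pair_measure_cong[OF sets_\<mu> refl] refl] .
qed

lemma \<phi>_mult_integrable:
  assumes f: "f \<in> L2_c T"
  shows "integrable M (\<lambda>x. \<phi> z x * f x)"
proof -
  obtain c d where cd: "{c..d} \<subseteq> sl_interval T" and supp: "AE x in M. x \<notin> {c..d} \<longrightarrow> f x = 0"
    using f by (auto simp: L2_c_def)
  have "bounded (\<phi> z ` {c..d})"
    by (intro compact_imp_bounded compact_continuous_image continuous_on_subset[OF \<phi>_continuous cd]) simp
  then obtain B where "\<And>x. x \<in> {c..d} \<Longrightarrow> cmod (\<phi> z x) \<le> B" by (meson bounded_iff imageI)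
  from bounded_on_Icc_in_L2[OF T cd \<phi>_measurable this]
  have int: "integrable M (\<lambda>x. (if x \<in> {c..d} then \<phi> z x else 0) * f x)"
    by (rule L2_integrable_mult[OF _ L2_c_L2[OF f]])
  have "(\<lambda>x. \<phi> z x * f x) \<in> borel_measurable M"
    using \<phi>_measurable L2_measurable[OF L2_c_L2[OF f]] by measurable
  moreover have "AE x in M. (if x \<in> {c..d} then \<phi> z x else 0) * f x = \<phi> z x * f x"
    using supp by eventually_elim auto
  ultimately show ?thesis
    using int integrable_cong_AE[of "\<lambda>x. (if x \<in> {c..d} then \<phi> z x else 0) * f x" M "\<lambda>x. \<phi> z x * f x"]
    by (simp add: borel_measurable_integrable)
qed

section \<open>Adjointness of the two transforms\<close>

text \<open>Continuity of \<open>\<phi>\<close> is given in x and in z separately, which yields no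
  bound on the integral of |\<phi> f| uniform for bounded t. Restricting g to those t where this
  integral is at most n makes the double integral absolutely convergent.\<close>

lemma transforms_adjoint_absolutely_convergent:
  assumes f: "f \<in> L2_c T" and g: "g \<in> L2 \<mu>"
    and supp: "\<And>t. g t \<noteq> 0 \<Longrightarrow> \<bar>t\<bar> \<le> real n \<and> (LINT x|M. cmod (\<phi> (of_real t) x * f x)) \<le> real n"
  shows "L2_inner M (G g) f = L2_inner \<mu> g (F f)"
proof -
  interpret pair_sigma_finite \<mu> M
    using sigma_finite_\<mu> sigma_finite_weighted[OF T] by (simp add: pair_sigma_finite_def)
  note fL = L2_c_L2[OF f]
  have [measurable]: "f \<in> borel_measurable M" "g \<in> borel_measurable \<mu>"
    "(\<lambda>(t, x). \<phi> (of_real t) x) \<in> borel_measurable (\<mu> \<Otimes>\<^sub>M M)"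
    using L2_measurable[OF fL] L2_measurable[OF g] \<phi>_jointly_measurable by auto
  have [measurable_cong]: "sets \<mu> = sets borel" by (rule sets_\<mu>)
  define \<rho> where "\<rho> t = (LINT x|M. cmod (\<phi> (of_real t) x * f x))" for t
  have [measurable]: "\<rho> \<in> borel_measurable \<mu>" unfolding \<rho>_def by measurable
  define K where "K t x = \<phi> (of_real t) x * g t * cnj (f x)" for t x
  have g_int: "integrable \<mu> g"
  proof -
    \<comment> \<open>The interval is open on the left, so its end must lie beyond -n to contain -n.
      Its finite measure puts the indicator in L2, and pairing with it shows that g is
      integrable.\<close>
    let ?I = "indicator {- real (Suc n)<..real n} :: real \<Rightarrow> complex"
    have "integrable \<mu> (indicat_real {- real (Suc n)<..real n})"
      using \<mu>_finite[of "- real (Suc n)" "real n"] by (simp add: sets_\<mu> less_top)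
    moreover have "(cmod (?I t))\<^sup>2 = indicat_real {- real (Suc n)<..real n} t" for t
      by (simp split: split_indicator)
    ultimately have "?I \<in> L2 \<mu>" by (simp add: L2_def)
    from L2_integrable_mult[OF this g] have "integrable \<mu> (\<lambda>t. ?I t * g t)" .
    moreover have "(\<lambda>t. ?I t * g t) = g"
    proof
      fix t show "?I t * g t = g t"
        using supp[of t] by (cases "g t = 0") (auto split: split_indicator)
    qed
    ultimately show ?thesis by (simp only:)
  qed
  have "integrable (\<mu> \<Otimes>\<^sub>M M) (case_prod K)"
  proof (rule Fubini_integrable)
    show "case_prod K \<in> borel_measurable (\<mu> \<Otimes>\<^sub>M M)" unfolding K_def by measurable
    have "(LINT x|M. norm (case_prod K (t, x))) = cmod (g t) * \<rho> t" for t
      unfolding \<rho>_def by (subst integral_mult_right_zero[symmetric]) (simp add: K_def norm_mult ac_simps)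
    moreover have "integrable \<mu> (\<lambda>t. cmod (g t) * \<rho> t)"
    proof (rule Bochner_Integration.integrable_bound)
      show "integrable \<mu> (\<lambda>t. real n * cmod (g t))" using g_int by simp
      have "norm (cmod (g t) * \<rho> t) \<le> norm (real n * cmod (g t))" for t
      proof (cases "g t = 0")
        case False
        have "0 \<le> \<rho> t" unfolding \<rho>_def by simp
        moreover have "\<rho> t \<le> real n" using supp[OF False] by (simp only: \<rho>_def)
        ultimately show ?thesis by (simp add: abs_mult mult.commute mult_right_mono)
      qed simp
      then show "AE t in \<mu>. norm (cmod (g t) * \<rho> t) \<le> norm (real n * cmod (g t))" by simp
    qed measurable
    ultimately show "integrable \<mu> (\<lambda>t. LINT x|M. norm (case_prod K (t, x)))" by simp
    show "AE t in \<mu>. integrable M (\<lambda>x. case_prod K (t, x))"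
    proof (intro AE_I2)
      fix t
      have "integrable M (\<lambda>x. g t * (\<phi> (of_real t) x * f x))"
        using \<phi>_mult_integrable[OF f] by simp
      then have "integrable M (\<lambda>x. norm (g t * (\<phi> (of_real t) x * f x)))"
        by (rule integrable_norm)
      moreover have "K t \<in> borel_measurable M"
        unfolding K_def using \<phi>_measurable by measurable
      ultimately show "integrable M (\<lambda>x. case_prod K (t, x))"
        unfolding prod.case by (rule Bochner_Integration.integrable_bound) (auto simp: K_def norm_mult ac_simps)
    qed
  qed
  from Fubini_integral[OF this]
  have Fubini: "(LINT x|M. LINT t|\<mu>. K t x) = (LINT t|\<mu>. LINT x|M. K t x)" .
  have "t \<notin> {- real n..real n} \<longrightarrow> g t = 0" for t
    using supp[of t] by (cases "g t = 0") auto
  then have "g \<in> L2_compact \<mu>"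
    using g unfolding L2_compact_def by blast
  from G_check[OF this] have Gg: "AE x in M. G g x = check \<mu> \<phi> g x" .
  have "L2_inner M (G g) f = (LINT x|M. LINT t|\<mu>. K t x)"
    unfolding L2_inner_def
  proof (rule integral_cong_AE)
    show "(\<lambda>x. G g x * cnj (f x)) \<in> borel_measurable M"
      using L2_measurable[OF G_L2[OF g]] by measurable
    show "(\<lambda>x. LINT t|\<mu>. K t x) \<in> borel_measurable M"
    proof -
      have "(\<lambda>(x, t). K t x) \<in> borel_measurable (M \<Otimes>\<^sub>M \<mu>)" unfolding K_def by measurable
      then show ?thesis by measurable
    qed
    show "AE x in M. G g x * cnj (f x) = (LINT t|\<mu>. K t x)"
      using Gg by eventually_elim (simp add: check_def K_def)
  qed
  also note Fubini
  also have "(LINT t|\<mu>. LINT x|M. K t x) = (LINT t|\<mu>. g t * cnj (F f t))"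
  proof (rule integral_cong_AE)
    show "(\<lambda>t. g t * cnj (F f t)) \<in> borel_measurable \<mu>"
      using L2_measurable[OF F_L2[OF fL]] by measurable
    show "(\<lambda>t. LINT x|M. K t x) \<in> borel_measurable \<mu>" unfolding K_def by measurable
    \<comment> \<open>Here t is real, so \<open>\<phi>\<close> is real and the conjugate may be
      taken of the whole product.\<close>
    have K_hat: "(LINT x|M. K t x) = g t * cnj (hat T \<phi> f (of_real t))" for t
    proof -
      have "(LINT x|M. K t x) = (LINT x|M. g t * cnj (\<phi> (of_real t) x * f x))"
        by (intro Bochner_Integration.integral_cong) (auto simp: K_def cnj_\<phi> space_weighted)
      also have "\<dots> = g t * (LINT x|M. cnj (\<phi> (of_real t) x * f x))" by (rule integral_mult_right_zero)
      also have "(LINT x|M. cnj (\<phi> (of_real t) x * f x)) = cnj (hat T \<phi> f (of_real t))"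
        unfolding hat_def by (rule Bochner_Integration.integral_cnj)
      finally show ?thesis .
    qed
    show "AE t in \<mu>. (LINT x|M. K t x) = g t * cnj (F f t)"
      using F_hat[OF f] by eventually_elim (simp add: K_hat)
  qed
  finally show ?thesis by (simp add: L2_inner_def)
qed

lemma transforms_adjoint:
  assumes f: "f \<in> L2 M" and g: "g \<in> L2 \<mu>"
  shows "L2_inner M (G g) f = L2_inner \<mu> g (F f)"
proof -
  have compact: "L2_inner M (G g) f = L2_inner \<mu> g (F f)" if f: "f \<in> L2_c T" for f
  proof -
    interpret sigma_finite_measure M by (rule sigma_finite_weighted[OF T])
    note fL = L2_c_L2[OF f]
    have [measurable]: "f \<in> borel_measurable M" "g \<in> borel_measurable \<mu>"
      "(\<lambda>(t, x). \<phi> (of_real t) x) \<in> borel_measurable (\<mu> \<Otimes>\<^sub>M M)"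
      using L2_measurable[OF fL] L2_measurable[OF g] \<phi>_jointly_measurable by auto
    have [measurable_cong]: "sets \<mu> = sets borel" by (rule sets_\<mu>)
    define \<rho> where "\<rho> t = (LINT x|M. cmod (\<phi> (of_real t) x * f x))" for t
    have \<rho>_meas: "\<rho> \<in> borel_measurable \<mu>" unfolding \<rho>_def by measurable
    \<comment> \<open>Both quantities are finite at each t, so every t satisfies \<open>P n\<close>
      for large n and the truncations of g converge in norm.\<close>
    define P where "P n t \<longleftrightarrow> \<bar>t\<bar> \<le> real n \<and> \<rho> t \<le> real n" for n t
    define s where "s n t = (if P n t then g t else 0)" for n t
    have P_sets: "{t \<in> space \<mu>. P n t} \<in> sets \<mu>" for n
      unfolding P_def using \<rho>_meas by measurable
    have lim: "(\<lambda>n. L2_norm \<mu> (\<lambda>t. s n t - g t)) \<longlonglongrightarrow> 0"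
      unfolding s_def
    proof (rule L2_truncation_tendsto[OF g P_sets])
      fix t
      obtain N where "max \<bar>t\<bar> (\<rho> t) \<le> real N" using real_arch_simple by blast
      then have "P n t" if "n \<ge> N" for n using that by (auto simp: P_def)
      then show "\<forall>\<^sub>F n in sequentially. P n t" by (auto simp: eventually_sequentially)
    qed
    have s: "s n \<in> L2 \<mu>" for n
    proof (rule L2_dominated[OF g, where C = 1])
      show "s n \<in> borel_measurable \<mu>"
        unfolding s_def using P_sets[of n] by (intro measurable_If) auto
    qed (auto simp: s_def)
    have "(\<lambda>n. L2_inner M (G (s n)) f) \<longlonglongrightarrow> L2_inner M (G g) f"
      by (intro L2_inner_tendsto_left G_L2 s g fL L2_bounded_linear_tendsto[OF G_bounded s g lim])
    moreover have "(\<lambda>n. L2_inner \<mu> (s n) (F f)) \<longlonglongrightarrow> L2_inner \<mu> g (F f)"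
      by (intro L2_inner_tendsto_left s g F_L2 fL lim)
    moreover have "L2_inner M (G (s n)) f = L2_inner \<mu> (s n) (F f)" for n
      by (rule transforms_adjoint_absolutely_convergent[OF f s, of n])
        (auto simp: s_def P_def \<rho>_def split: if_splits)
    ultimately show ?thesis by (simp add: LIMSEQ_unique)
  qed
  obtain s where s: "\<And>n. s n \<in> L2_c T" and lim: "(\<lambda>n. L2_norm M (\<lambda>x. s n x - f x)) \<longlonglongrightarrow> 0"
    using L2_c_dense[OF T f] by blast
  have "(\<lambda>n. L2_inner M (G g) (s n)) \<longlonglongrightarrow> L2_inner M (G g) f"
    by (intro L2_inner_tendsto_right L2_c_L2 s f G_L2 g lim)
  moreover have "(\<lambda>n. L2_inner \<mu> g (F (s n))) \<longlonglongrightarrow> L2_inner \<mu> g (F f)"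
    by (intro L2_inner_tendsto_right F_L2 L2_c_L2 s f g L2_bounded_linear_tendsto[OF F_bounded _ f lim])
  ultimately show ?thesis by (simp add: compact[OF s] LIMSEQ_unique)
qed

section \<open>Invariance of the range of the transform and triviality of its complement\<close>

lemma inverse_diff_mult_L2:
  assumes z: "Im z \<noteq> 0" and g: "g \<in> L2 \<mu>"
  shows "(\<lambda>t. inverse (of_real t - z) * g t) \<in> L2 \<mu>"
proof (rule L2_dominated[OF g])
  have [measurable_cong]: "sets \<mu> = sets borel" by (rule sets_\<mu>)
  show "(\<lambda>t. inverse (of_real t - z) * g t) \<in> borel_measurable \<mu>"
    using L2_measurable[OF g] by measurable
  show "AE t in \<mu>. cmod (inverse (of_real t - z) * g t) \<le> inverse \<bar>Im z\<bar> * cmod (g t)"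
    by (intro AE_I2) (auto simp: norm_mult intro!: mult_right_mono cmod_inverse_of_real_diff_le[OF z])
qed

text \<open>The density formula alone only identifies the projection of \<open>F f / (t - z)\<close> to the range of \<open>F\<close>
  with the transform of the resolvent; equality of the norms upgrades this to an identity.\<close>

lemma F_resolvent:
  assumes z: "Im z \<noteq> 0" and f: "f \<in> L2_c T"
  shows "AE t in \<mu>. F (resolvent M (dom_S T v) (tau T) z f) t = inverse (of_real t - z) * F f t"
proof -
  define u where "u = resolvent M (dom_S T v) (tau T) z f"
  define h where "h t = inverse (of_real t - z) * F f t" for t
  note fL = L2_c_L2[OF f]
  have uL: "u \<in> L2 M"
    unfolding u_def by (intro self_adjoint_operatorD(1)[OF sa] self_adjoint_resolvent[OF sa z fL])
  have hL: "h \<in> L2 \<mu>" unfolding h_def by (rule inverse_diff_mult_L2[OF z F_L2[OF fL]])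
  have weak_c: "L2_inner M u g = L2_inner \<mu> h (F g)" if g: "g \<in> L2_c T" for g
  proof -
    let ?k = "\<lambda>t. hat T \<phi> f (of_real t) * cnj (hat T \<phi> g (of_real t))"
    have int: "integrable \<mu> ?k" and
      E: "resolvent_measure M (dom_S T v) (tau T) f g (\<lambda>A. LINT t:A|\<mu>. ?k t)"
      using density f g by (auto simp: spectral_density_formula_def)
    have "has_complex_measure_integral (\<lambda>A. LINT t:A|\<mu>. ?k t) (\<lambda>t. inverse (of_real t - z)) (L2_inner M u g)"
      using E self_adjoint_nonreal_resolvent[OF sa z] by (simp add: resolvent_measure_def u_def)
    from has_complex_measure_integral_density[OF sets_\<mu> int this _ cmod_inverse_of_real_diff_le[OF z]]
    have "L2_inner M u g = (LINT t|\<mu>. inverse (of_real t - z) * ?k t)" by simp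
    also have "\<dots> = L2_inner \<mu> h (F g)"
      unfolding L2_inner_def
    proof (rule integral_cong_AE)
      have [measurable_cong]: "sets \<mu> = sets borel" by (rule sets_\<mu>)
      show "(\<lambda>t. inverse (of_real t - z) * ?k t) \<in> borel_measurable \<mu>"
        using borel_measurable_integrable[OF int] by measurable
      show "(\<lambda>t. h t * cnj (F g t)) \<in> borel_measurable \<mu>"
        using L2_measurable[OF hL] L2_measurable[OF F_L2[OF L2_c_L2[OF g]]] by measurable
      show "AE t in \<mu>. inverse (of_real t - z) * ?k t = h t * cnj (F g t)"
        using F_hat[OF f] F_hat[OF g] by eventually_elim (simp add: h_def)
    qed
    finally show ?thesis .
  qed
  have weak: "L2_inner M u g = L2_inner \<mu> h (F g)" if g: "g \<in> L2 M" for g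
  proof -
    obtain s where s: "\<And>n. s n \<in> L2_c T" and lim: "(\<lambda>n. L2_norm M (\<lambda>x. s n x - g x)) \<longlonglongrightarrow> 0"
      using L2_c_dense[OF T g] by blast
    have "(\<lambda>n. L2_inner M u (s n)) \<longlonglongrightarrow> L2_inner M u g"
      by (intro L2_inner_tendsto_right L2_c_L2 s g uL lim)
    moreover have "(\<lambda>n. L2_inner \<mu> h (F (s n))) \<longlonglongrightarrow> L2_inner \<mu> h (F g)"
      by (intro L2_inner_tendsto_right F_L2 L2_c_L2 s g hL L2_bounded_linear_tendsto[OF F_bounded _ g lim])
    ultimately show ?thesis by (simp add: weak_c[OF s] LIMSEQ_unique)
  qed
  \<comment> \<open>The weak identity is tested with f itself: each side is Im z times a squared
    norm, and division by Im z equates the norms of u and h.\<close>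
  have "Im z * (L2_norm M u)\<^sup>2 = Im (L2_inner \<mu> h (F f))"
    using self_adjoint_Im_resolvent[OF sa z fL] weak[OF fL] by (simp add: u_def)
  also have "\<dots> = (LINT t|\<mu>. Im (h t * cnj (F f t)))"
    unfolding L2_inner_def by (rule integral_Im[OF L2_integrable_inner[OF hL F_L2[OF fL]], symmetric])
  also have "\<dots> = (LINT t|\<mu>. Im z * (cmod (h t))\<^sup>2)"
  proof (intro Bochner_Integration.integral_cong refl)
    fix t
    have eq: "h t * cnj (F f t) = inverse (of_real t - z) * of_real ((cmod (F f t))\<^sup>2)"
      unfolding complex_norm_square by (simp add: h_def)
    have "Im (h t * cnj (F f t)) = Im (inverse (of_real t - z)) * (cmod (F f t))\<^sup>2"
      unfolding eq by (simp del: of_real_power)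
    also have "Im (inverse (of_real t - z)) = Im z * (cmod (inverse (of_real t - z)))\<^sup>2"
      by (simp add: norm_inverse power_inverse cmod_power2 divide_inverse)
    finally show "Im (h t * cnj (F f t)) = Im z * (cmod (h t))\<^sup>2"
      by (simp add: h_def norm_mult power_mult_distrib mult.assoc)
  qed
  also have "\<dots> = Im z * (L2_norm \<mu> h)\<^sup>2" by (simp add: L2_norm_power2)
  finally have norm_h: "(L2_norm \<mu> h)\<^sup>2 = (L2_norm M u)\<^sup>2" using z by simp
  \<comment> \<open>Testing the weak identity with u gives <h, F u> = |u|^2, so all three terms are
    multiples of |u|^2 and cancel.\<close>
  have "(L2_norm \<mu> (\<lambda>t. 1 * F u t + (-1) * h t))\<^sup>2
      = (L2_norm \<mu> (F u))\<^sup>2 + (L2_norm \<mu> h)\<^sup>2 - 2 * Re (cnj (L2_inner \<mu> h (F u)))"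
    unfolding L2_norm_power2_lincomb[OF F_L2[OF uL] hL] L2_inner_cnj by simp
  also have "\<dots> = 0"
    using F_isometry uL norm_h by (simp add: weak[OF uL, symmetric] L2_inner_self L2_isometry_def)
  finally have "L2_norm \<mu> (\<lambda>t. F u t - h t) = 0" by simp
  from L2_norm_eq_0[OF L2_diff[OF F_L2[OF uL] hL] this] show ?thesis
    by (simp add: u_def h_def)
qed

text \<open>Multiplying \<open>F f\<close> by 1 / (t - z) stays in the range, so orthogonality of g
  to the range says that the Stieltjes transform of the density \<open>F f\<close> cnj g vanishes at
  every nonreal z.\<close>

lemma orthogonal_range_imp_product_zero:
  assumes g: "g \<in> L2 \<mu>" and orth: "\<And>f. f \<in> L2 M \<Longrightarrow> L2_inner \<mu> (F f) g = 0" and f: "f \<in> L2_c T"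
  shows "AE t in \<mu>. F f t * cnj (g t) = 0"
proof (rule Stieltjes_transform_zero[OF sets_\<mu> sigma_finite_\<mu>])
  note fL = L2_c_L2[OF f]
  show "integrable \<mu> (\<lambda>t. F f t * cnj (g t))"
    by (rule L2_integrable_inner[OF F_L2[OF fL] g])
  fix z :: complex assume z: "Im z \<noteq> 0"
  let ?u = "resolvent M (dom_S T v) (tau T) z f"
  have uL: "?u \<in> L2 M"
    by (intro self_adjoint_operatorD(1)[OF sa] self_adjoint_resolvent[OF sa z fL])
  have "L2_inner \<mu> (\<lambda>t. inverse (of_real t - z) * F f t) g = L2_inner \<mu> (F ?u) g"
    using F_resolvent[OF z f]
    by (intro L2_inner_cong inverse_diff_mult_L2 z F_L2 fL uL g) (auto elim: eventually_mono)
  then show "(LINT t|\<mu>. inverse (of_real t - z) * (F f t * cnj (g t))) = 0"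
    using orth[OF uL] by (simp add: L2_inner_def mult.assoc)
qed

text \<open>Rational end points keep the family of test functions countable, so that one null set serves them all.\<close>

lemma hat_indicator_nonzero:
  obtains c d :: rat where "{real_of_rat c..real_of_rat d} \<subseteq> sl_interval T"
    "hat T \<phi> (indicator {real_of_rat c..real_of_rat d}) (of_real t) \<noteq> 0"
proof -
  obtain x where x: "x \<in> sl_interval T" "\<phi> (of_real t) x \<noteq> 0" using \<phi>_nonzero by blast
  \<comment> \<open>For real t the solution is real, so dividing by its value at x gives a real
    continuous function equal to 1 at x. It exceeds 1/2 nearby, hence nothing can cancel in the
    integral over a small interval.\<close>
  define w where "w x' = Re (\<phi> (of_real t) x' / \<phi> (of_real t) x)" for x'
  have \<phi>_eq: "\<phi> (of_real t) x' = of_real (w x') * \<phi> (of_real t) x" if "x' \<in> sl_interval T" for x'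
  proof -
    have "\<phi> (of_real t) x' / \<phi> (of_real t) x \<in> \<real>"
      using cnj_\<phi>[OF that] cnj_\<phi>[OF x(1)] by (simp add: Reals_cnj_iff)
    then have "of_real (w x') = \<phi> (of_real t) x' / \<phi> (of_real t) x" unfolding w_def by simp
    then show ?thesis using x(2) by simp
  qed
  have "continuous_on (sl_interval T) w"
    unfolding w_def by (intro continuous_intros \<phi>_continuous) (simp add: x(2))
  moreover have "w x = 1" using x(2) by (simp add: w_def)
  ultimately have "\<forall>\<^sub>F x' in at x. 1/2 < w x'"
    using x(1) open_sl_interval by (intro order_tendstoD(1)[of w "1"]) (auto simp: continuous_on_eq_continuous_at isCont_def)
  moreover have "\<forall>\<^sub>F x' in at x. x' \<in> sl_interval T"
    by (rule eventually_at_in_open'[OF open_sl_interval x(1)])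
  ultimately have "\<forall>\<^sub>F x' in at x. 1/2 < w x' \<and> x' \<in> sl_interval T" by (rule eventually_conj)
  then obtain e where "e > 0" and e: "\<And>x'. x' \<noteq> x \<Longrightarrow> dist x' x < e \<Longrightarrow> 1/2 < w x' \<and> x' \<in> sl_interval T"
    by (auto simp: eventually_at)
  obtain c where c: "x - e < real_of_rat c" "real_of_rat c < x" using of_rat_dense[of "x - e" x] \<open>e > 0\<close> by auto
  obtain d where d: "x < real_of_rat d" "real_of_rat d < x + e" using of_rat_dense[of x "x + e"] \<open>e > 0\<close> by auto
  let ?I = "{real_of_rat c..real_of_rat d}"
  have I: "1/2 \<le> w x' \<and> x' \<in> sl_interval T" if "x' \<in> ?I" for x'
  proof (cases "x' = x")
    case False
    have "dist x' x < e" using that c d unfolding dist_real_def abs_less_iff by simp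
    from e[OF False this] show ?thesis by simp
  qed (simp add: x(1) \<open>w x = 1\<close>)
  then have sub: "?I \<subseteq> sl_interval T" by blast
  have [measurable]: "?I \<in> sets M" by (rule Icc_sets_weighted[OF sub])
  have ind: "integrable M (indicat_real ?I)"
    using emeasure_weighted_Icc_finite[OF T sub] by (simp add: less_top)
  have [measurable]: "w \<in> borel_measurable M"
    unfolding w_def using \<phi>_measurable by measurable
  have "bounded (w ` ?I)"
    by (intro compact_imp_bounded compact_continuous_image
        continuous_on_subset[OF \<open>continuous_on (sl_interval T) w\<close> sub]) simp
  then obtain B where B: "\<And>x. x \<in> ?I \<Longrightarrow> \<bar>w x\<bar> \<le> B" by (metis bounded_iff imageI real_norm_def)
  have int: "integrable M (\<lambda>x'. w x' * indicat_real ?I x')"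
  proof (rule Bochner_Integration.integrable_bound)
    show "integrable M (\<lambda>x'. B * indicat_real ?I x')" using ind by simp
    show "AE x' in M. norm (w x' * indicat_real ?I x') \<le> norm (B * indicat_real ?I x')"
      using B by (intro AE_I2) (auto split: split_indicator intro: order.trans[OF B abs_ge_self])
  qed measurable
  have "0 < measure M ?I"
    using emeasure_weighted_Icc_pos[OF T sub] emeasure_weighted_Icc_finite[OF T sub] c(2) d(1)
    by (simp add: measure_def enn2real_positive_iff zero_less_iff_neq_zero)
  then have "0 < (LINT x'|M. 1/2 * indicat_real ?I x')" by simp
  also have "\<dots> \<le> (LINT x'|M. w x' * indicat_real ?I x')"
    using I by (intro integral_mono ind int integrable_mult_right) (auto split: split_indicator)
  finally have pos: "(LINT x'|M. w x' * indicat_real ?I x') \<noteq> 0" by simp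
  have "hat T \<phi> (indicator ?I) (of_real t)
      = (LINT x'|M. of_real (w x' * indicat_real ?I x') * \<phi> (of_real t) x)"
    unfolding hat_def using \<phi>_eq
    by (intro Bochner_Integration.integral_cong) (auto simp: space_weighted split: split_indicator)
  also have "\<dots> = of_real (LINT x'|M. w x' * indicat_real ?I x') * \<phi> (of_real t) x"
    by (simp only: integral_mult_left_zero integral_complex_of_real)
  finally have "hat T \<phi> (indicator ?I) (of_real t) \<noteq> 0" using pos x(2) by simp
  with sub that show ?thesis by blast
qed

lemma orthogonal_range_imp_zero:
  assumes g: "g \<in> L2 \<mu>" and orth: "\<And>f. f \<in> L2 M \<Longrightarrow> L2_inner \<mu> (F f) g = 0"
  shows "AE t in \<mu>. g t = 0"
proof -
  define J :: "(rat \<times> rat) set" where "J = {(c, d). {real_of_rat c..real_of_rat d} \<subseteq> sl_interval T}"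
  let ?e = "\<lambda>(c, d). indicator {real_of_rat c..real_of_rat d} :: real \<Rightarrow> complex"
  have e: "?e j \<in> L2_c T" if "j \<in> J" for j
  proof -
    obtain c d where j: "j = (c, d)" by (cases j)
    then have sub: "{real_of_rat c..real_of_rat d} \<subseteq> sl_interval T" using that by (simp add: J_def)
    have eq: "indicator {real_of_rat c..real_of_rat d} = (\<lambda>x. if x \<in> {real_of_rat c..real_of_rat d} then 1 else (0::complex))"
      by (rule ext) (simp add: indicator_def)
    have "(\<lambda>x. if x \<in> {real_of_rat c..real_of_rat d} then 1 else (0::complex)) \<in> L2 M"
      by (rule bounded_on_Icc_in_L2[OF T sub, where B = 1]) auto
    from L2_c_truncation[OF this sub] show ?thesis unfolding j prod.case eq by (simp cong: if_cong)
  qed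
  have "AE t in \<mu>. hat T \<phi> (?e j) (of_real t) * cnj (g t) = 0" if "j \<in> J" for j
  proof -
    have "AE t in \<mu>. F (?e j) t * cnj (g t) = 0"
      by (rule orthogonal_range_imp_product_zero[OF g orth e[OF that]])
    with F_hat[OF e[OF that]] show ?thesis by eventually_elim simp
  qed
  then have "AE t in \<mu>. \<forall>j\<in>J. hat T \<phi> (?e j) (of_real t) * cnj (g t) = 0"
    by (subst AE_ball_countable) auto
  then show ?thesis
  proof eventually_elim
    case (elim t)
    \<comment> \<open>The interval may depend on t, since the exceptional null set was already fixed
      for the whole countable family.\<close>
    obtain c d where "(c, d) \<in> J" "hat T \<phi> (?e (c, d)) (of_real t) \<noteq> 0"
      using hat_indicator_nonzero[of t] unfolding J_def by auto
    with elim show ?case by fastforce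
  qed
qed

section \<open>The transforms are mutually inverse\<close>

lemma G_F:
  assumes f: "f \<in> L2 M"
  shows "AE x in M. G (F f) x = f x"
proof -
  let ?d = "\<lambda>x. G (F f) x - f x"
  have GF: "G (F f) \<in> L2 M" by (intro G_L2 F_L2 f)
  have d: "?d \<in> L2 M" by (rule L2_diff[OF GF f])
  have "L2_inner M ?d ?d = L2_inner M (G (F f)) ?d - L2_inner M f ?d"
    by (rule L2_inner_diff_left[OF GF f d])
  also have "\<dots> = 0"
    using transforms_adjoint[OF d F_L2[OF f]] L2_isometry_inner[OF F_isometry f d] by simp
  finally have "L2_norm M ?d = 0" by (simp add: L2_inner_self)
  from L2_norm_eq_0[OF d this] show ?thesis by simp
qed

text \<open>Adjointness and isometry give <F (G h), F f> = <G h, f> = <h, F f>, so F (G h) - h is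
  orthogonal to the range and must vanish.\<close>

lemma F_G:
  assumes h: "h \<in> L2 \<mu>"
  shows "AE t in \<mu>. F (G h) t = h t"
proof -
  have FG: "F (G h) \<in> L2 \<mu>" by (intro G_L2 F_L2 h)
  have "AE t in \<mu>. F (G h) t - h t = 0"
  proof (rule orthogonal_range_imp_zero[OF L2_diff[OF FG h]])
    fix f assume f: "f \<in> L2 M"
    have "cnj (L2_inner \<mu> (\<lambda>t. F (G h) t - h t) (F f)) = 0"
      using transforms_adjoint[OF f h] L2_isometry_inner[OF F_isometry G_L2[OF h] f]
      by (simp add: L2_inner_diff_left[OF FG h F_L2[OF f]])
    then show "L2_inner \<mu> (F f) (\<lambda>t. F (G h) t - h t) = 0" by (simp only: L2_inner_cnj)
  qed
  then show ?thesis by simp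
qed

end

theorem lemma9p2:
  fixes T :: sl_data
    and v :: "endpoint \<Rightarrow> real \<Rightarrow> complex"
    and \<theta> \<phi> :: "complex \<Rightarrow> real \<Rightarrow> complex"
    and m :: "complex \<Rightarrow> complex"
    and \<mu> :: "real measure"
    and F G :: "(real \<Rightarrow> complex) \<Rightarrow> (real \<Rightarrow> complex)"
  assumes expression: "sl_expression T"
    and boundary: "\<And>e. limit_circle T e \<Longrightarrow> boundary_function T e (v e)"
    and self_adjoint: "self_adjoint_operator (weighted T) (dom_S T v) (tau T)"
    and fundamental: "real_entire_fundamental_system T \<theta> \<phi>"
    and wronskian_one: "\<And>z x. x \<in> sl_interval T \<Longrightarrow> wronskian T (\<theta> z) (\<phi> z) x = 1"
    and phi_near_a: "\<And>z. in_dom_S_near T v Lower (\<phi> z)"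
    and weyl: "singular_weyl_function T v \<theta> \<phi> m"
    and measure: "spectral_measure m \<mu>"
    and density_known: "spectral_density_formula T v \<phi> \<mu>"
    and F: "spectral_transform T \<phi> \<mu> F"
    and G: "inverse_spectral_transform T \<phi> \<mu> G"
  shows "L2_unitary (weighted T) \<mu> F \<and> L2_inverse (weighted T) \<mu> F G"
proof -
  interpret spectral_pair T v \<phi> \<mu> F G
  proof
    show "sets \<mu> = sets borel" "\<And>l1 l2. l1 < l2 \<Longrightarrow> emeasure \<mu> {l1<..l2} \<noteq> \<infinity>"
      using measure by (auto simp: spectral_measure_def)
    fix z
    have "\<phi> z \<in> AC_loc T"
      using fundamental by (auto simp: real_entire_fundamental_system_def solution_def D_tau_def)
    then show "continuous_on (sl_interval T) (\<phi> z)" by (rule AC_loc_imp_continuous_on)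
    have "\<And>\<alpha> \<beta>. (\<forall>x\<in>sl_interval T. \<alpha> * \<theta> z x + \<beta> * \<phi> z x = 0) \<Longrightarrow> \<alpha> = 0 \<and> \<beta> = 0"
      using fundamental unfolding real_entire_fundamental_system_def by blast
    from this[of 0 1] show "\<exists>x\<in>sl_interval T. \<phi> z x \<noteq> 0" by auto
  next
    fix x assume "x \<in> sl_interval T"
    then show "real_entire (\<lambda>z. \<phi> z x)"
      using fundamental by (auto simp: real_entire_fundamental_system_def)
  qed fact+
  have "L2_linear (weighted T) \<mu> F" using F_isometry by (simp add: L2_isometry_def)
  \<comment> \<open>Surjectivity is witnessed by \<open>G h\<close> as a preimage of h.\<close>
  then have "L2_unitary (weighted T) \<mu> F"
    unfolding L2_unitary_def using L2_isometry_inner[OF F_isometry] G_L2 F_G by blast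
  moreover have "L2_inverse (weighted T) \<mu> F G"
    unfolding L2_inverse_def using F_L2 G_L2 G_F F_G by blast
  ultimately show ?thesis by blast
qed

end
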